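(* (i) If a Banach space $E$ has the W.A.P., then the Banach algebra $W(E)$ has a B.L.A.I. (bounded left approximate identity). (ii) $W(J)$ has a B.L.A.I., where $J$ is James' space.
   Context: For a Banach space $E$, $W(E)$ denotes the Banach algebra of weakly compact operators $E\to E$ with the operator norm. A Banach space $E$ has the weakly compact approximation property (W.A.P.) if there is a constant $C<\infty$ such that for every weakly compact set $D\subset E$ and every $\varepsilon>0$ there is $V\in W(E)$ with $\sup_{x\in D}\|x-Vx\|<\varepsilon$ and $\|V\|\le C$. A Banach algebra $A$ has a bounded left approximate identity (B.L.A.I.) if there is a bounded net $(x_\alpha)\subset A$ such that $\lim_\alpha\|y-x_\alpha y\|=0$ for all $y\in A$. James' space $J$ is the Banach space of real sequences $x=(x_j)_{j\ge1}$ with $\lim_j x_j=0$ and $\|x\|^2=\sup\sum_{j=1}^n|x_{p_{j+1}}-x_{p_j}|^2<\infty$, where the supremum is over all $n\in\mathbb N$ and $1\le p_1<\dots<p_n<p_{n+1}$. *)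

theory Defs
  imports "HOL-Analysis.Analysis"
begin

text \<open>
  A complete field with a multiplicative norm extending that of the reals is the real or the
  complex field.  A Banach space over such a scalar field is an element of the class
  \<open>banach\<close> (which carries the norm and the real scalar multiplication) together with a
  scalar multiplication extending the real one.
\<close>

locale banach_space_over = vector_space smul
  for smul :: "'k::{real_normed_field, banach} \<Rightarrow> 'e::banach \<Rightarrow> 'e" +
  assumes scale_of_real: "smul (of_real r) x = r *\<^sub>R x"
    and norm_scale: "norm (smul c x) = norm c * norm x"

lemma banach_space_over_scaleR: "banach_space_over ((*\<^sub>R) :: real \<Rightarrow> 'e::banach \<Rightarrow> 'e)"
  by unfold_locales (auto simp: algebra_simps)

lemma banach_space_over_complex: "banach_space_over ((*) :: complex \<Rightarrow> complex \<Rightarrow> complex)"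
  by unfold_locales (auto simp: algebra_simps norm_mult scaleR_conv_of_real)

definition dual_space :: "('k::{real_normed_field, banach} \<Rightarrow> 'e::banach \<Rightarrow> 'e) \<Rightarrow> ('e \<Rightarrow> 'k) set"
  where "dual_space smul = {f. bounded_linear f \<and> (\<forall>c x. f (smul c x) = c * f x)}"

definition weak_topology :: "('k::{real_normed_field, banach} \<Rightarrow> 'e::banach \<Rightarrow> 'e) \<Rightarrow> 'e topology"
  where "weak_topology smul =
    topology_generated_by {f -` U | f U. f \<in> dual_space smul \<and> open U}"

abbreviation weakly_compact :: "('k::{real_normed_field, banach} \<Rightarrow> 'e::banach \<Rightarrow> 'e) \<Rightarrow> 'e set \<Rightarrow> bool"
  where "weakly_compact smul D \<equiv> compactin (weak_topology smul) D"

definition weakly_compact_operators ::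
    "('k::{real_normed_field, banach} \<Rightarrow> 'e::banach \<Rightarrow> 'e) \<Rightarrow> ('e \<Rightarrow>\<^sub>L 'e) set"
  where "weakly_compact_operators smul =
    {T. (\<forall>c x. blinfun_apply T (smul c x) = smul c (blinfun_apply T x)) \<and>
        weakly_compact smul (weak_topology smul closure_of (blinfun_apply T ` cball 0 1))}"

text \<open>The number \<open>\<delta>\<close> expresses that the supremum of \<open>norm (x - V x)\<close> over \<open>D\<close> is less than
  \<open>\<epsilon>\<close>, avoiding the unspecified supremum over the empty set.\<close>

definition has_WAP :: "('k::{real_normed_field, banach} \<Rightarrow> 'e::banach \<Rightarrow> 'e) \<Rightarrow> bool"
  where "has_WAP smul \<longleftrightarrow>
    (\<exists>C. \<forall>D \<epsilon>. weakly_compact smul D \<and> \<epsilon> > 0 \<longrightarrow>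
      (\<exists>V \<in> weakly_compact_operators smul.
        (\<exists>\<delta><\<epsilon>. \<forall>x\<in>D. norm (x - blinfun_apply V x) \<le> \<delta>) \<and> norm V \<le> C))"

definition directed_set :: "'i set \<Rightarrow> ('i \<Rightarrow> 'i \<Rightarrow> bool) \<Rightarrow> bool"
  where "directed_set I le \<longleftrightarrow> I \<noteq> {} \<and> reflp_on I le \<and> transp_on I le \<and>
    (\<forall>i\<in>I. \<forall>j\<in>I. \<exists>k\<in>I. le i k \<and> le j k)"

text \<open>
  Here \<open>A\<close> is (the carrier of) a Banach algebra with product \<open>prd\<close> and the norm of the
  ambient type.  Nets are
  indexed by arbitrary directed sets inside the type \<open>'a set \<times> nat\<close>.  This is no loss of generality:
  any bounded left approximate identity gives rise to one indexed by the pairs of a finite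
  subset \<open>S\<close> of \<open>A\<close> and \<open>n\<close>, by choosing a member \<open>e\<close> of the given net with
  \<open>norm (y - prd e y) < 1 / (n + 1)\<close> for \<open>y \<in> S\<close>.
\<close>

definition has_BLAI :: "('a::real_normed_vector \<Rightarrow> 'a \<Rightarrow> 'a) \<Rightarrow> 'a set \<Rightarrow> bool"
  where "has_BLAI prd A \<longleftrightarrow>
    (\<exists>(I :: ('a set \<times> nat) set) le e C.
      directed_set I le \<and>
      (\<forall>i\<in>I. e i \<in> A \<and> norm (e i) \<le> C) \<and>
      (\<forall>y\<in>A. \<forall>\<epsilon>>0. \<exists>i0\<in>I. \<forall>i\<in>I. le i0 i \<longrightarrow> norm (y - prd (e i) y) < \<epsilon>))"

text \<open>Sequences are indexed from 0 instead of 1.\<close>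

definition james_variations :: "(nat \<Rightarrow> real) \<Rightarrow> real set"
  where "james_variations x =
    {\<Sum>j<n. \<bar>x (p (Suc j)) - x (p j)\<bar>\<^sup>2 | n p. strict_mono_on {..n} p}"

typedef james = "{x :: nat \<Rightarrow> real. x \<longlonglongrightarrow> 0 \<and> bdd_above (james_variations x)}"
  morphisms james_seq Abs_james
proof -
  have "james_variations (\<lambda>_. 0) \<subseteq> {0}"
    by (auto simp: james_variations_def)
  then have "bdd_above (james_variations (\<lambda>_. 0))"
    by (rule bdd_above_mono[rotated]) auto
  then show ?thesis
    by (intro exI[of _ "\<lambda>_. 0"]) auto
qed

definition james_bound :: "(nat \<Rightarrow> real) \<Rightarrow> real \<Rightarrow> bool"
  where "james_bound x c \<longleftrightarrow> 0 \<le> c \<and>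
    (\<forall>n p. strict_mono_on {..n} p \<longrightarrow> L2_set (\<lambda>j. x (p (Suc j)) - x (p j)) {..<n} \<le> c)"

lemma james_variations_eq_L2:
  "james_variations x =
    {(L2_set (\<lambda>j. x (p (Suc j)) - x (p j)) {..<n})\<^sup>2 | n p. strict_mono_on {..n} p}"
  by (simp add: james_variations_def L2_set_def sum_nonneg)

lemma zero_in_james_variations: "0 \<in> james_variations x"
  unfolding james_variations_def
  by (rule CollectI, rule exI[of _ 0], rule exI[of _ id]) (auto simp: strict_mono_on_def)

lemma james_bound_imp_le: "james_bound x c \<Longrightarrow> v \<in> james_variations x \<Longrightarrow> v \<le> c\<^sup>2"
  by (auto simp: james_bound_def james_variations_eq_L2 intro!: power_mono)

lemma james_bound_imp_bdd: "james_bound x c \<Longrightarrow> bdd_above (james_variations x)"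
  by (rule bdd_aboveI) (rule james_bound_imp_le)

lemma james_bound_Sup:
  assumes "bdd_above (james_variations x)"
  shows "james_bound x (sqrt (Sup (james_variations x)))"
  unfolding james_bound_def
proof (intro conjI allI impI)
  have "0 \<le> Sup (james_variations x)"
    by (rule cSup_upper[OF zero_in_james_variations assms])
  then show "0 \<le> sqrt (Sup (james_variations x))" by simp
  fix n p
  assume "strict_mono_on {..n} (p :: nat \<Rightarrow> nat)"
  then have "(L2_set (\<lambda>j. x (p (Suc j)) - x (p j)) {..<n})\<^sup>2 \<in> james_variations x"
    by (auto simp: james_variations_eq_L2)
  from cSup_upper[OF this assms]
  show "L2_set (\<lambda>j. x (p (Suc j)) - x (p j)) {..<n} \<le> sqrt (Sup (james_variations x))"
    by (rule real_le_rsqrt)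
qed

lemma Sup_james_le:
  assumes "james_bound x c"
  shows "sqrt (Sup (james_variations x)) \<le> c"
proof -
  have "Sup (james_variations x) \<le> c\<^sup>2"
    using zero_in_james_variations james_bound_imp_le[OF assms] by (intro cSup_least) auto
  then show ?thesis
    using assms by (intro real_le_lsqrt) (auto simp: james_bound_def)
qed

lemma james_bound_add:
  assumes "james_bound x a" "james_bound y b"
  shows "james_bound (\<lambda>i. x i + y i) (a + b)"
  unfolding james_bound_def
proof (intro conjI allI impI)
  show "0 \<le> a + b" using assms by (auto simp: james_bound_def)
  fix n p
  assume p: "strict_mono_on {..n} (p :: nat \<Rightarrow> nat)"
  have "L2_set (\<lambda>j. (x (p (Suc j)) + y (p (Suc j))) - (x (p j) + y (p j))) {..<n} =
      L2_set (\<lambda>j. (x (p (Suc j)) - x (p j)) + (y (p (Suc j)) - y (p j))) {..<n}"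
    by (simp add: algebra_simps)
  also have "\<dots> \<le> L2_set (\<lambda>j. x (p (Suc j)) - x (p j)) {..<n}
      + L2_set (\<lambda>j. y (p (Suc j)) - y (p j)) {..<n}"
    by (rule L2_set_triangle_ineq)
  also have "\<dots> \<le> a + b"
    using assms p by (auto simp: james_bound_def intro!: add_mono)
  finally show "L2_set (\<lambda>j. (x (p (Suc j)) + y (p (Suc j))) - (x (p j) + y (p j))) {..<n} \<le> a + b" .
qed

lemma james_bound_scale:
  assumes "james_bound x a"
  shows "james_bound (\<lambda>i. r * x i) (\<bar>r\<bar> * a)"
  unfolding james_bound_def
proof (intro conjI allI impI)
  show "0 \<le> \<bar>r\<bar> * a" using assms by (auto simp: james_bound_def)
  fix n p
  assume p: "strict_mono_on {..n} (p :: nat \<Rightarrow> nat)"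
  have "L2_set (\<lambda>j. r * x (p (Suc j)) - r * x (p j)) {..<n} =
      \<bar>r\<bar> * L2_set (\<lambda>j. x (p (Suc j)) - x (p j)) {..<n}"
    by (simp add: L2_set_def power_mult_distrib real_sqrt_mult
        flip: right_diff_distrib sum_distrib_left)
  also have "\<dots> \<le> \<bar>r\<bar> * a"
    using assms p by (auto simp: james_bound_def intro!: mult_left_mono)
  finally show "L2_set (\<lambda>j. r * x (p (Suc j)) - r * x (p j)) {..<n} \<le> \<bar>r\<bar> * a" .
qed

lemma james_bound_coord:
  assumes "james_bound x c" "x \<longlonglongrightarrow> 0"
  shows "\<bar>x i\<bar> \<le> c"
proof -
  have "\<bar>x m - x i\<bar> \<le> c" if "i < m" for m
  proof -
    define p where "p = (\<lambda>j::nat. if j = 0 then i else m)"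
    have "strict_mono_on {..1} p"
      using that by (auto simp: strict_mono_on_def p_def)
    then have "L2_set (\<lambda>j. x (p (Suc j)) - x (p j)) {..<1} \<le> c"
      using assms(1) unfolding james_bound_def by blast
    then show ?thesis by (simp add: p_def L2_set_def)
  qed
  then have "eventually (\<lambda>m. \<bar>x m - x i\<bar> \<le> c) sequentially"
    by (auto intro: eventually_sequentiallyI[of "Suc i"])
  moreover have "(\<lambda>m. \<bar>x m - x i\<bar>) \<longlonglongrightarrow> \<bar>0 - x i\<bar>"
    by (intro tendsto_intros assms)
  ultimately have "\<bar>0 - x i\<bar> \<le> c"
    by (intro tendsto_upperbound[where F = sequentially]) auto
  then show ?thesis by simp
qed

lemma james_seq_tendsto: "james_seq x \<longlonglongrightarrow> 0"
  and james_seq_bdd: "bdd_above (james_variations (james_seq x))"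
  using james_seq[of x] by auto

lemma james_seq_Abs:
  assumes "x \<longlonglongrightarrow> 0" "james_bound x c"
  shows "james_seq (Abs_james x) = x"
  using assms james_bound_imp_bdd by (intro Abs_james_inverse) auto

instantiation james :: real_normed_vector
begin

definition zero_james :: james where "0 = Abs_james (\<lambda>_. 0)"
definition plus_james :: "james \<Rightarrow> james \<Rightarrow> james"
  where "x + y = Abs_james (\<lambda>i. james_seq x i + james_seq y i)"
definition scaleR_james :: "real \<Rightarrow> james \<Rightarrow> james"
  where "r *\<^sub>R x = Abs_james (\<lambda>i. r * james_seq x i)"
definition uminus_james :: "james \<Rightarrow> james"
  where "- x = Abs_james (\<lambda>i. - james_seq x i)"
definition minus_james :: "james \<Rightarrow> james \<Rightarrow> james"
  where "x - y = Abs_james (\<lambda>i. james_seq x i - james_seq y i)"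
definition norm_james :: "james \<Rightarrow> real"
  where "norm_james x = sqrt (Sup (james_variations (james_seq x)))"
definition dist_james :: "james \<Rightarrow> james \<Rightarrow> real"
  where "dist_james x y = norm (x - y)"
definition sgn_james :: "james \<Rightarrow> james"
  where "sgn_james x = inverse (norm x) *\<^sub>R x"
definition uniformity_james :: "(james \<times> james) filter"
  where "uniformity_james = (INF e\<in>{0<..}. principal {(x, y). dist x (y::james) < e})"
definition open_james :: "james set \<Rightarrow> bool"
  where "open_james U \<longleftrightarrow> (\<forall>x\<in>U. eventually (\<lambda>(x', y). x' = x \<longrightarrow> y \<in> U) uniformity)"

lemma james_bound_norm: "james_bound (james_seq x) (norm x)"
  unfolding norm_james_def by (rule james_bound_Sup[OF james_seq_bdd])

lemma norm_james_le: "james_bound (james_seq x) c \<Longrightarrow> norm x \<le> c"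
  unfolding norm_james_def by (rule Sup_james_le)

lemma james_seq_zero [simp]: "james_seq 0 = (\<lambda>_. 0)"
  unfolding zero_james_def
  by (rule james_seq_Abs[of _ 0]) (auto simp: james_bound_def L2_set_def)

lemma james_seq_plus [simp]: "james_seq (x + y) = (\<lambda>i. james_seq x i + james_seq y i)"
  unfolding plus_james_def
  by (rule james_seq_Abs[OF _ james_bound_add[OF james_bound_norm james_bound_norm]])
    (rule tendsto_eq_intros james_seq_tendsto | simp)+

lemma james_seq_scaleR [simp]: "james_seq (r *\<^sub>R x) = (\<lambda>i. r * james_seq x i)"
  unfolding scaleR_james_def
  by (rule james_seq_Abs[OF _ james_bound_scale[OF james_bound_norm]])
    (rule tendsto_eq_intros james_seq_tendsto | simp)+

lemma james_seq_uminus [simp]: "james_seq (- x) = (\<lambda>i. - james_seq x i)"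
  using james_seq_scaleR[of "-1" x] unfolding scaleR_james_def uminus_james_def by simp

lemma james_seq_minus [simp]: "james_seq (x - y) = (\<lambda>i. james_seq x i - james_seq y i)"
  using james_seq_plus[of x "- y"] unfolding plus_james_def minus_james_def by simp

lemma james_eq_iff: "x = y \<longleftrightarrow> (\<forall>i. james_seq x i = james_seq y i)"
  by (metis ext james_seq_inject)

instance
proof
  fix x y z :: james and a b :: real and U :: "james set"
  show "x + y + z = x + (y + z)" "x + y = y + x" "0 + x = x" "- x + x = 0" "x - y = x + - y"
    "a *\<^sub>R (x + y) = a *\<^sub>R x + a *\<^sub>R y" "(a + b) *\<^sub>R x = a *\<^sub>R x + b *\<^sub>R x"
    "a *\<^sub>R b *\<^sub>R x = (a * b) *\<^sub>R x" "1 *\<^sub>R x = x"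
    by (auto simp: james_eq_iff algebra_simps)
  show "dist x y = norm (x - y)" by (rule dist_james_def)
  show "sgn x = inverse (norm x) *\<^sub>R x" by (rule sgn_james_def)
  show "uniformity = (INF e\<in>{0<..}. principal {(x, y). dist x (y::james) < e})"
    by (rule uniformity_james_def)
  show "open U \<longleftrightarrow> (\<forall>x\<in>U. eventually (\<lambda>(x', y). x' = x \<longrightarrow> y \<in> U) uniformity)"
    by (rule open_james_def)
  show "norm (x + y) \<le> norm x + norm y"
    using james_bound_add[OF james_bound_norm[of x] james_bound_norm[of y]]
    by (intro norm_james_le) simp
  show "norm x = 0 \<longleftrightarrow> x = 0"
  proof
    assume "norm x = 0"
    then have "\<bar>james_seq x i\<bar> \<le> 0" for i
      using james_bound_coord[OF james_bound_norm james_seq_tendsto, of x i] by simp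
    then show "x = 0" by (simp add: james_eq_iff)
  next
    assume "x = 0"
    then have "norm x \<le> 0"
      by (intro norm_james_le) (simp add: james_bound_def L2_set_def)
    then show "norm x = 0"
      using james_bound_norm[of x] by (simp add: james_bound_def)
  qed
  have le: "norm (r *\<^sub>R z) \<le> \<bar>r\<bar> * norm z" for r and z :: james
    using james_bound_scale[OF james_bound_norm[of z], of r] by (intro norm_james_le) simp
  show "norm (a *\<^sub>R x) = \<bar>a\<bar> * norm x"
  proof (cases "a = 0")
    case True
    then have "a *\<^sub>R x = 0" by (simp add: james_eq_iff)
    then show ?thesis
      using le[of a x] True james_bound_norm[of "a *\<^sub>R x"] by (simp add: james_bound_def)
  next
    case False
    then have "x = inverse a *\<^sub>R (a *\<^sub>R x)" by (simp add: james_eq_iff)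
    then have "norm x \<le> \<bar>inverse a\<bar> * norm (a *\<^sub>R x)" using le by metis
    then have "\<bar>a\<bar> * norm x \<le> norm (a *\<^sub>R x)"
      using False by (simp add: field_simps)
    then show ?thesis using le[of a x] by simp
  qed
qed

end

instance james :: banach
proof
  fix X :: "nat \<Rightarrow> james"
  assume X: "Cauchy X"
  have coord: "\<bar>james_seq x i\<bar> \<le> norm x" for x i
    by (rule james_bound_coord[OF james_bound_norm james_seq_tendsto])
  have "Cauchy (\<lambda>n. james_seq (X n) i)" for i
  proof (rule CauchyI)
    fix e :: real
    assume "0 < e"
    then obtain N where N: "norm (X m - X n) < e" if "m \<ge> N" "n \<ge> N" for m n
      using CauchyD[OF X] by blast
    have "norm (james_seq (X m) i - james_seq (X n) i) < e" if "m \<ge> N" "n \<ge> N" for m n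
      using coord[of "X m - X n" i] N[OF that] by simp
    then show "\<exists>N. \<forall>m\<ge>N. \<forall>n\<ge>N. norm (james_seq (X m) i - james_seq (X n) i) < e" by blast
  qed
  then have "\<exists>l. (\<lambda>n. james_seq (X n) i) \<longlonglongrightarrow> l" for i
    by (simp add: Cauchy_convergent_iff convergent_def)
  then obtain y where y: "\<And>i. (\<lambda>n. james_seq (X n) i) \<longlonglongrightarrow> y i"
    by metis
  have key: "\<exists>N. \<forall>m\<ge>N. james_bound (\<lambda>i. james_seq (X m) i - y i) e \<and>
      (\<forall>i. \<bar>james_seq (X m) i - y i\<bar> \<le> e)" if "0 < e" for e
  proof -
    obtain N where N: "norm (X m - X n) < e" if "m \<ge> N" "n \<ge> N" for m n
      using CauchyD[OF X \<open>0 < e\<close>] by blast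
    have "james_bound (\<lambda>i. james_seq (X m) i - y i) e" if m: "m \<ge> N" for m
      unfolding james_bound_def
    proof (intro conjI allI impI)
      show "0 \<le> e" using \<open>0 < e\<close> by simp
      fix k p
      assume p: "strict_mono_on {..k} (p :: nat \<Rightarrow> nat)"
      let ?f = "\<lambda>n. L2_set (\<lambda>j. (james_seq (X m) (p (Suc j)) - james_seq (X n) (p (Suc j)))
          - (james_seq (X m) (p j) - james_seq (X n) (p j))) {..<k}"
      have "?f n \<le> e" if "n \<ge> N" for n
      proof -
        have "?f n \<le> norm (X m - X n)"
          using james_bound_norm[of "X m - X n"] p by (simp add: james_bound_def)
        also have "\<dots> \<le> e" using N[OF m that] by simp
        finally show ?thesis .
      qed
      then have "eventually (\<lambda>n. ?f n \<le> e) sequentially"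
        by (auto intro: eventually_sequentiallyI)
      moreover have "?f \<longlonglongrightarrow> L2_set (\<lambda>j. (james_seq (X m) (p (Suc j)) - y (p (Suc j)))
          - (james_seq (X m) (p j) - y (p j))) {..<k}"
        unfolding L2_set_def by (intro tendsto_intros y)
      ultimately show "L2_set (\<lambda>j. (james_seq (X m) (p (Suc j)) - y (p (Suc j)))
          - (james_seq (X m) (p j) - y (p j))) {..<k} \<le> e"
        by (intro tendsto_upperbound[where F = sequentially]) auto
    qed
    moreover have "\<bar>james_seq (X m) i - y i\<bar> \<le> e" if m: "m \<ge> N" for m i
    proof -
      have "\<bar>james_seq (X m) i - james_seq (X n) i\<bar> \<le> e" if "n \<ge> N" for n
        using coord[of "X m - X n" i] N[OF m that] by simp
      then have "eventually (\<lambda>n. \<bar>james_seq (X m) i - james_seq (X n) i\<bar> \<le> e) sequentially"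
        by (auto intro: eventually_sequentiallyI)
      moreover have "(\<lambda>n. \<bar>james_seq (X m) i - james_seq (X n) i\<bar>) \<longlonglongrightarrow> \<bar>james_seq (X m) i - y i\<bar>"
        by (intro tendsto_intros y)
      ultimately show ?thesis
        by (intro tendsto_upperbound[where F = sequentially]) auto
    qed
    ultimately show ?thesis by blast
  qed
  have y0: "y \<longlonglongrightarrow> 0"
  proof (rule LIMSEQ_I)
    fix e :: real
    assume "0 < e"
    then obtain m where m: "\<And>i. \<bar>james_seq (X m) i - y i\<bar> \<le> e / 2"
      using key[of "e / 2"] by auto
    obtain K where K: "\<And>i. i \<ge> K \<Longrightarrow> \<bar>james_seq (X m) i\<bar> < e / 2"
      using LIMSEQ_D[OF james_seq_tendsto[of "X m"], of "e / 2"] \<open>0 < e\<close> by auto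
    have "norm (y i - 0) < e" if "i \<ge> K" for i
      using m[of i] K[OF that] by (simp only: real_norm_def abs_if split: if_splits) linarith+
    then show "\<exists>K. \<forall>i\<ge>K. norm (y i - 0) < e" by blast
  qed
  obtain m where m: "james_bound (\<lambda>i. james_seq (X m) i - y i) 1"
    using key[of 1] by auto
  have "james_bound y (norm (X m) + \<bar>-1\<bar> * 1)"
    using james_bound_add[OF james_bound_norm[of "X m"] james_bound_scale[OF m, of "-1"]] by simp
  then have Y: "james_seq (Abs_james y) = y"
    using y0 james_seq_Abs by blast
  have "X \<longlonglongrightarrow> Abs_james y"
  proof (rule LIMSEQ_I)
    fix e :: real
    assume e: "0 < e"
    then obtain N where N: "\<And>m. m \<ge> N \<Longrightarrow> james_bound (\<lambda>i. james_seq (X m) i - y i) (e / 2)"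
      using key[of "e / 2"] by auto
    have "norm (X m - Abs_james y) \<le> e / 2" if "m \<ge> N" for m
      using N[OF that] by (intro norm_james_le) (simp add: Y)
    then show "\<exists>N. \<forall>m\<ge>N. norm (X m - Abs_james y) < e"
      using e by (intro exI[of _ N]) fastforce
  qed
  then show "convergent X" by (auto simp: convergent_def)
qed

end

theory Submission
  imports Defs
begin

text \<open>
  For (i), apply the W.A.P. to the union of the weak closures of \<open>T\<close>(unit ball), for \<open>T\<close> in a finite
  set of weakly compact operators.

  For (ii), cut the index set into consecutive finite blocks and let \<open>Q x\<close> be the sequence that is
  constant on each block, with value an average of some coordinates of \<open>x\<close> in that block.  Then
  \<open>norm Q \<le> 1\<close>, and \<open>V = I - Q\<close> is weakly compact: sequences with vanishing block averages and
  norm at most 2 form a set that is compact for coordinatewise convergence, and on bounded subsets of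
  \<open>J\<close> this is the weak topology, because the unit vector basis of \<open>J\<close> is shrinking.  It remains to
  choose the averages such that \<open>Q T\<close> is small for \<open>T\<close> in a given finite set.  If \<open>T\<close> is weakly
  compact, the bidual of \<open>T\<close> maps the constant sequence 1 into \<open>J\<close>, so the functionals
  \<open>x \<mapsto> (T x)\<^sub>i\<close> tend to 0 at every point of the bidual \<open>J \<oplus> \<real> 1\<close> of \<open>J\<close>; a gliding hump
  argument then yields averages of them that are small in norm.
\<close>

section \<open>Quadratic variation along sorted lists\<close>

text \<open>Lists allow concatenation, reindexing by \<open>map\<close> and induction. Repeated
  adjacent entries add 0, so weakly sorted lists serve as well as strictly increasing ones.\<close>

fun variation :: "(nat \<Rightarrow> real) \<Rightarrow> nat list \<Rightarrow> real" where
  "variation x (a # b # l) = (x b - x a)\<^sup>2 + variation x (b # l)"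
| "variation x _ = 0"

lemma variation_snoc: "variation x (l @ [a, b]) = variation x (l @ [a]) + (x b - x a)\<^sup>2"
  by (induction x l rule: variation.induct) auto

lemma variation_append: "variation x l + variation x l' \<le> variation x (l @ l')"
proof (induction l rule: induct_list012)
  case (2 a)
  then show ?case by (cases l') auto
qed auto

lemma variation_comp: "variation (\<lambda>i. x (f i)) l = variation x (map f l)"
  by (induction x l rule: variation.induct) auto

lemma variation_remdups_adj: "variation x (remdups_adj l) = variation x l"
proof (induction l rule: remdups_adj.induct)
  case (3 a b l)
  then show ?case
    by (cases "remdups_adj (b # l)") (auto split: if_splits, metis list.sel(1) remdups_adj_Cons_alt hd_remdups_adj)
qed auto

lemma sorted_distinct_adj_strict: "sorted l \<Longrightarrow> distinct_adj l \<Longrightarrow> sorted_wrt (<) (l :: nat list)"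
  by (induction l rule: induct_list012) (auto simp: less_le_trans)

lemma variation_map_upt: "variation x (map p [0..<Suc n]) = (\<Sum>j<n. (x (p (Suc j)) - x (p j))\<^sup>2)"
proof (induction n)
  case (Suc n)
  then show ?case using variation_snoc[of x "map p [0..<n]" "p n" "p (Suc n)"] by simp
qed auto

text \<open>Removing adjacent repetitions makes a sorted list strictly increasing and keeps its
  variation. Admitting repetitions lets non-injective monotone reindexings preserve the
  bound.\<close>

lemma james_bound_iff_variation:
  "james_bound x c \<longleftrightarrow> 0 \<le> c \<and> (\<forall>l. sorted l \<longrightarrow> variation x l \<le> c\<^sup>2)"
proof
  assume L: "james_bound x c"
  have "variation x l \<le> c\<^sup>2" if "sorted l" for l
  proof (cases "l = []")
    case False
    let ?l = "remdups_adj l"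
    obtain n where n: "length ?l = Suc n"
      using False by (cases ?l) (auto simp: remdups_adj_Nil_iff)
    have "sorted_wrt (<) ?l"
      using that by (intro sorted_distinct_adj_strict) auto
    then have "strict_mono_on {..n} ((!) ?l)"
      using n by (auto simp: strict_mono_on_def sorted_wrt_iff_nth_less)
    then have "L2_set (\<lambda>j. x (?l ! Suc j) - x (?l ! j)) {..<n} \<le> c"
      using L unfolding james_bound_def by blast
    then have "(\<Sum>j<n. (x (?l ! Suc j) - x (?l ! j))\<^sup>2) \<le> c\<^sup>2"
      unfolding L2_set_def by (rule sqrt_le_D)
    also have "(\<Sum>j<n. (x (?l ! Suc j) - x (?l ! j))\<^sup>2) = variation x ?l"
      using n by (metis variation_map_upt map_nth)
    finally show ?thesis by (simp add: variation_remdups_adj)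
  qed auto
  then show "0 \<le> c \<and> (\<forall>l. sorted l \<longrightarrow> variation x l \<le> c\<^sup>2)"
    using L by (auto simp: james_bound_def)
next
  assume R: "0 \<le> c \<and> (\<forall>l. sorted l \<longrightarrow> variation x l \<le> c\<^sup>2)"
  show "james_bound x c"
    unfolding james_bound_def
  proof (intro conjI allI impI)
    show "0 \<le> c" using R by simp
    fix n p
    assume "strict_mono_on {..n} (p :: nat \<Rightarrow> nat)"
    then have "sorted (map p [0..<Suc n])"
      by (auto simp: sorted_iff_nth_mono simp del: upt_Suc dest!: strict_mono_on_imp_mono_on
          intro: mono_onD)
    then show "L2_set (\<lambda>j. x (p (Suc j)) - x (p j)) {..<n} \<le> c"
      unfolding L2_set_def using R variation_map_upt[of x p n]
      by (intro real_le_lsqrt) (auto simp: sum_nonneg simp del: upt_Suc)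
  qed
qed

lemma james_boundD: "james_bound x c \<Longrightarrow> sorted l \<Longrightarrow> variation x l \<le> c\<^sup>2"
  by (simp add: james_bound_iff_variation)

lemma james_bound_nonneg: "james_bound x c \<Longrightarrow> 0 \<le> c"
  by (simp add: james_bound_def)

lemma james_boundI: "0 \<le> c \<Longrightarrow> (\<And>l. sorted l \<Longrightarrow> variation x l \<le> c\<^sup>2) \<Longrightarrow> james_bound x c"
  by (simp add: james_bound_iff_variation)

lemma james_bound_weaken: "james_bound x c \<Longrightarrow> c \<le> d \<Longrightarrow> james_bound x d"
  by (fastforce simp: james_bound_def)

lemma sorted_map_mono: "mono f \<Longrightarrow> sorted l \<Longrightarrow> sorted (map f l)"
  by (auto simp: sorted_wrt_map elim!: sorted_wrt_mono_rel[rotated] dest: monoD)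

lemma james_bound_comp_mono:
  assumes "james_bound x c" "mono f"
  shows "james_bound (\<lambda>i. x (f i)) c"
  using assms by (auto simp: james_bound_iff_variation variation_comp sorted_map_mono)

text \<open>At each index at most one summand is nonzero, so a jump of the sum involves at most two
  summands and Cauchy-Schwarz costs a factor 2.\<close>

lemma variation_sum_disjoint:
  assumes "finite I" and disj: "\<And>i m m'. m \<in> I \<Longrightarrow> m' \<in> I \<Longrightarrow> m \<noteq> m' \<Longrightarrow> z m i = 0 \<or> z m' i = 0"
  shows "variation (\<lambda>i. \<Sum>m\<in>I. z m i) l \<le> 2 * (\<Sum>m\<in>I. variation (z m) l)"
proof -
  have key: "((\<Sum>m\<in>I. z m q) - (\<Sum>m\<in>I. z m p))\<^sup>2 \<le> 2 * (\<Sum>m\<in>I. (z m q - z m p)\<^sup>2)" for p q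
  proof -
    have card1: "card {m \<in> I. z m i \<noteq> 0} \<le> Suc 0" for i
      using assms by (subst card_le_Suc0_iff_eq) auto
    define G where "G = {m \<in> I. z m q \<noteq> 0} \<union> {m \<in> I. z m p \<noteq> 0}"
    have "card G \<le> 2"
      using card_Un_le[of "{m \<in> I. z m q \<noteq> 0}" "{m \<in> I. z m p \<noteq> 0}"] card1[of p] card1[of q]
      by (simp add: G_def)
    have "(\<Sum>m\<in>I. z m q) - (\<Sum>m\<in>I. z m p) = (\<Sum>m\<in>G. z m q - z m p)"
      unfolding sum_subtractf[symmetric]
      by (rule sum.mono_neutral_right) (use assms in \<open>auto simp: G_def\<close>)
    then have "((\<Sum>m\<in>I. z m q) - (\<Sum>m\<in>I. z m p))\<^sup>2 \<le> real (card G) * (\<Sum>m\<in>G. (z m q - z m p)\<^sup>2)"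
      using sum_squared_le_sum_of_squares[of "\<lambda>m. z m q - z m p" G] by (simp add: mult.commute)
    also have "\<dots> \<le> 2 * (\<Sum>m\<in>I. (z m q - z m p)\<^sup>2)"
      using \<open>card G \<le> 2\<close> assms(1)
      by (intro mult_mono sum_mono2) (auto simp: G_def sum_nonneg)
    finally show ?thesis .
  qed
  show ?thesis
  \<comment> \<open>The rule wants a sequence argument, which stays fixed in the recursion;
    \<open>z undefined\<close> is a placeholder for it.\<close>
  proof (induction "z undefined" l rule: variation.induct)
    case (1 a b l)
    then show ?case using key[of b a] by (simp add: sum.distrib distrib_left)
  qed auto
qed

text \<open>Otherwise lists of variation above \<open>e\<close> exist beyond every index, and
  concatenating \<open>k\<close> of them gives a sorted list of variation at least
  \<open>k * e\<close>.\<close>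

lemma variation_tail_small:
  assumes "james_bound x c" "0 < e"
  shows "\<exists>n. \<forall>l. sorted l \<longrightarrow> set l \<subseteq> {n..} \<longrightarrow> variation x l \<le> e"
proof (rule ccontr)
  assume "\<not> ?thesis"
  then have ex: "\<exists>l. sorted l \<and> set l \<subseteq> {n..} \<and> e < variation x l" for n
    by (meson not_le)
  have "\<exists>l. sorted l \<and> real k * e \<le> variation x l" for k
  proof (induction k)
    case 0
    then show ?case by (auto intro: exI[of _ "[]"])
  next
    case (Suc k)
    then obtain l where l: "sorted l" "real k * e \<le> variation x l" by blast
    obtain l' where l': "sorted l'" "set l' \<subseteq> {Max (insert 0 (set l))..}" "e < variation x l'"
      using ex by blast
    have "sorted (l @ l')" using l l' by (fastforce simp: sorted_append)
    moreover have "real (Suc k) * e \<le> variation x (l @ l')"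
      using l l' variation_append[of x l l'] by (simp add: algebra_simps)
    ultimately show ?case by blast
  qed
  moreover obtain k where "c\<^sup>2 < real k * e" using assms(2) reals_Archimedean3 by blast
  ultimately show False using james_boundD[OF assms(1)] by (meson not_le order_trans)
qed

lemma james_bound_convergent:
  assumes "james_bound x c"
  shows "convergent x"
proof -
  have "Cauchy x"
  proof (rule metric_CauchyI)
    fix e :: real assume "0 < e"
    then obtain n where n: "\<And>l. sorted l \<Longrightarrow> set l \<subseteq> {n..} \<Longrightarrow> variation x l \<le> (e / 2)\<^sup>2"
      using variation_tail_small[OF assms, of "(e/2)\<^sup>2"] by auto
    have *: "\<bar>x j - x i\<bar> < e" if "n \<le> i" "i \<le> j" for i j
    proof -
      have "(x j - x i)\<^sup>2 \<le> (e / 2)\<^sup>2" using n[of "[i, j]"] that by simp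
      then have "\<bar>x j - x i\<bar> \<le> \<bar>e / 2\<bar>" by (rule abs_le_square_iff[THEN iffD2])
      then show ?thesis using \<open>0 < e\<close> by simp
    qed
    have "dist (x i) (x j) < e" if "n \<le> i" "n \<le> j" for i j
      using *[of i j] *[of j i] that by (cases "i \<le> j") (auto simp: dist_real_def abs_minus_commute)
    then show "\<exists>M. \<forall>m\<ge>M. \<forall>n\<ge>M. dist (x m) (x n) < e" by blast
  qed
  then show ?thesis by (simp add: Cauchy_convergent)
qed

lemma james_bound_indicator: "james_bound (\<lambda>i. if i < n then 1 else 0) 1"
proof (rule james_boundI)
  fix l :: "nat list" assume "sorted l"
  \<comment> \<open>Strengthened for the induction: the single drop from 1 to 0 can only lie ahead
    if the list starts below \<open>n\<close>.\<close>
  then have "variation (\<lambda>i. if i < n then 1 else 0) l \<le> (if l \<noteq> [] \<and> hd l < n then 1 else 0)"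
  proof (induction l rule: induct_list012)
    case (3 a b l)
    then show ?case by (auto split: if_splits)
  qed auto
  also have "\<dots> \<le> 1\<^sup>2" by simp
  finally show "variation (\<lambda>i. if i < n then 1 else 0) l \<le> 1\<^sup>2" .
qed simp

text \<open>\<open>x (max n i)\<close> is a monotone reindexing of \<open>x\<close>; subtracting
  \<open>x n\<close> times the indicator of the indices below \<open>n\<close> removes its constant
  initial part.\<close>

lemma james_bound_tail:
  assumes "0 \<le> c" and *: "\<And>l. sorted l \<Longrightarrow> set l \<subseteq> {n..} \<Longrightarrow> variation x l \<le> c\<^sup>2"
  shows "james_bound (\<lambda>i. if i < n then 0 else x i) (c + \<bar>x n\<bar>)"
proof -
  have "mono (max n)" by (simp add: monoI)
  then have "james_bound (\<lambda>i. x (max n i)) c"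
    using assms by (intro james_boundI) (auto simp: variation_comp sorted_map_mono intro!: *)
  from james_bound_add[OF this james_bound_scale[OF james_bound_indicator[of n], of "- x n"]]
  have "james_bound (\<lambda>i. x (max n i) + - x n * (if i < n then 1 else 0)) (c + \<bar>x n\<bar>)" by simp
  also have "(\<lambda>i. x (max n i) + - x n * (if i < n then 1 else 0)) = (\<lambda>i. if i < n then 0 else x i)"
    by (auto simp: max_def)
  finally show ?thesis .
qed

text \<open>Freezing \<open>x\<close> from \<open>n\<close> on and subtracting \<open>x n\<close>
  never leaves the window; truncating at \<open>m\<close> adds a jump of at most \<open>c\<close>,
  whence the factor 2.\<close>

lemma james_bound_window:
  assumes "m \<le> n" "0 \<le> c" and *: "\<And>l. sorted l \<Longrightarrow> set l \<subseteq> {m..n} \<Longrightarrow> variation x l \<le> c\<^sup>2"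
  shows "james_bound (\<lambda>i. if m \<le> i \<and> i < n then x i - x n else 0) (2 * c)"
proof -
  have "variation (\<lambda>i. x (min i n) - x n) l \<le> c\<^sup>2" if "sorted l" "set l \<subseteq> {m..}" for l
  proof -
    have "variation (\<lambda>i. x (min i n) - x n) l = variation x (map (\<lambda>i. min i n) l)"
      by (induction l rule: induct_list012) auto
    also have "\<dots> \<le> c\<^sup>2"
      using that \<open>m \<le> n\<close> by (intro * sorted_map_mono) (auto simp: monoI min.coboundedI1)
    finally show ?thesis .
  qed
  from james_bound_tail[where n = m and x = "\<lambda>i. x (min i n) - x n", OF assms(2) this]
  have "james_bound (\<lambda>i. if i < m then 0 else x (min i n) - x n) (c + \<bar>x m - x n\<bar>)"
    using \<open>m \<le> n\<close> by (simp add: min_def)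
  moreover have "\<bar>x m - x n\<bar> \<le> c"
    using *[of "[m, n]"] \<open>m \<le> n\<close> \<open>0 \<le> c\<close> abs_le_square_iff[of "x m - x n" c]
    by (simp add: power2_commute)
  moreover have "(\<lambda>i. if i < m then 0 else x (min i n) - x n)
      = (\<lambda>i. if m \<le> i \<and> i < n then x i - x n else 0)"
    by (auto simp: min_def)
  ultimately show ?thesis using james_bound_weaken[of _ "c + \<bar>x m - x n\<bar>" "2 * c"] by auto
qed

section \<open>Tails and the shrinking basis of James' space\<close>

lemma norm_Abs_james_le:
  "james_bound x c \<Longrightarrow> x \<longlonglongrightarrow> 0 \<Longrightarrow> norm (Abs_james x) \<le> c"
  by (rule norm_james_le) (simp add: james_seq_Abs)

lemma abs_james_seq_le_norm: "\<bar>james_seq x i\<bar> \<le> norm x"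
  by (rule james_bound_coord[OF james_bound_norm james_seq_tendsto])

lemma bounded_linear_james_seq: "bounded_linear (\<lambda>x. james_seq x i)"
  by (rule bounded_linear_intro[where K = 1]) (use abs_james_seq_le_norm in auto)

lemma james_seq_sum: "james_seq (\<Sum>m\<in>I. z m) = (\<lambda>i. \<Sum>m\<in>I. james_seq (z m) i)"
  by (rule ext, rule linear_sum[OF bounded_linear.linear[OF bounded_linear_james_seq]])

lemma variation_le_norm: "sorted l \<Longrightarrow> variation (james_seq x) l \<le> (norm x)\<^sup>2"
  by (rule james_boundD[OF james_bound_norm])

definition james_rest :: "nat \<Rightarrow> james \<Rightarrow> james"
  where "james_rest n x = Abs_james (\<lambda>i. if i < n then 0 else james_seq x i)"

lemma tendsto_rest: "x \<longlonglongrightarrow> (0::real) \<Longrightarrow> (\<lambda>i. if i < n then 0 else x i) \<longlonglongrightarrow> 0"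
  by (erule Lim_transform_eventually) (auto simp: eventually_sequentially intro!: exI[of _ n])

lemma james_bound_rest:
  "james_bound (\<lambda>i. if i < n then 0 else james_seq x i) (norm x + \<bar>james_seq x n\<bar>)"
  by (rule james_bound_tail) (auto intro: variation_le_norm)

lemma james_seq_rest [simp]: "james_seq (james_rest n x) = (\<lambda>i. if i < n then 0 else james_seq x i)"
  unfolding james_rest_def
  by (rule james_seq_Abs[OF tendsto_rest[OF james_seq_tendsto] james_bound_rest])

lemma norm_james_rest_le: "norm (james_rest n x) \<le> 2 * norm x"
proof -
  have "norm (james_rest n x) \<le> norm x + \<bar>james_seq x n\<bar>"
    by (rule norm_james_le) (simp add: james_bound_rest)
  then show ?thesis using abs_james_seq_le_norm[of x n] by simp
qed

lemma james_rest_tendsto: "(\<lambda>n. james_rest n x) \<longlonglongrightarrow> 0"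
proof (rule LIMSEQ_I)
  fix e :: real assume "0 < e"
  then obtain m where m: "\<And>l. sorted l \<Longrightarrow> set l \<subseteq> {m..} \<Longrightarrow> variation (james_seq x) l \<le> (e / 3)\<^sup>2"
    using variation_tail_small[OF james_bound_norm, of "(e/3)\<^sup>2" x] by auto
  obtain k where k: "\<And>i. i \<ge> k \<Longrightarrow> \<bar>james_seq x i\<bar> < e / 3"
    using LIMSEQ_D[OF james_seq_tendsto, of "e/3" x] \<open>0 < e\<close> by auto
  have "norm (james_rest n x - 0) < e" if "n \<ge> max m k" for n
  proof -
    have "norm (james_rest n x) \<le> e / 3 + \<bar>james_seq x n\<bar>"
      using that \<open>0 < e\<close>
      by (intro norm_james_le) (force simp: intro!: james_bound_tail m)
    then show ?thesis using k[of n] that \<open>0 < e\<close> by simp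
  qed
  then show "\<exists>no. \<forall>n\<ge>no. norm (james_rest n x - 0) < e" by blast
qed

definition james_ones :: "nat \<Rightarrow> james"
  where "james_ones n = Abs_james (\<lambda>i. if i < n then 1 else 0)"

lemma tendsto_ones: "(\<lambda>i. if i < n then 1 else (0::real)) \<longlonglongrightarrow> 0"
  by (rule Lim_transform_eventually[OF tendsto_const])
    (auto simp: eventually_sequentially intro!: exI[of _ n])

lemma james_seq_ones [simp]: "james_seq (james_ones n) = (\<lambda>i. if i < n then 1 else 0)"
  unfolding james_ones_def by (rule james_seq_Abs[OF tendsto_ones james_bound_indicator])

lemma norm_james_ones_le: "norm (james_ones n) \<le> 1"
  by (rule norm_james_le) (simp add: james_bound_indicator)

definition james_unit :: "nat \<Rightarrow> james"
  where "james_unit k = james_ones (Suc k) - james_ones k"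

lemma james_seq_unit [simp]: "james_seq (james_unit k) = (\<lambda>i. if i = k then 1 else 0)"
  by (auto simp: james_unit_def)

lemma james_minus_rest: "x - james_rest n x = (\<Sum>k<n. james_seq x k *\<^sub>R james_unit k)"
  by (auto simp: james_eq_iff james_seq_sum if_distrib cong: if_cong)

text \<open>An upper 2-estimate: \<open>N\<close> disjointly supported vectors of bounded norm have
  a sum of norm of order \<open>sqrt N\<close> only.\<close>

lemma norm_james_sum_disjoint:
  assumes "finite I" "\<And>i m m'. m \<in> I \<Longrightarrow> m' \<in> I \<Longrightarrow> m \<noteq> m' \<Longrightarrow>
      james_seq (z m) i = 0 \<or> james_seq (z m') i = 0"
  shows "(norm (\<Sum>m\<in>I. z m))\<^sup>2 \<le> 2 * (\<Sum>m\<in>I. (norm (z m))\<^sup>2)"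
proof -
  have "norm (\<Sum>m\<in>I. z m) \<le> sqrt (2 * (\<Sum>m\<in>I. (norm (z m))\<^sup>2))"
  proof (intro norm_james_le james_boundI)
    fix l :: "nat list" assume l: "sorted l"
    have "variation (james_seq (\<Sum>m\<in>I. z m)) l \<le> 2 * (\<Sum>m\<in>I. variation (james_seq (z m)) l)"
      unfolding james_seq_sum by (rule variation_sum_disjoint[OF assms])
    also have "\<dots> \<le> 2 * (\<Sum>m\<in>I. (norm (z m))\<^sup>2)"
      using l by (intro mult_left_mono sum_mono variation_le_norm) auto
    finally show "variation (james_seq (\<Sum>m\<in>I. z m)) l \<le> (sqrt (2 * (\<Sum>m\<in>I. (norm (z m))\<^sup>2)))\<^sup>2"
      by (simp add: sum_nonneg)
  qed (simp add: sum_nonneg)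
  then show ?thesis by (simp add: sqrt_ge_absD)
qed

text \<open>If the conclusion fails, there are infinitely many disjoint blocks of norm at most 3 on which
  \<open>f > \<epsilon>\<close>; the sum of \<open>N\<close> of them has norm of order \<open>sqrt N\<close>, but \<open>f\<close> is at least
  \<open>N * \<epsilon>\<close> there.\<close>

lemma james_basis_shrinking:
  fixes f :: "james \<Rightarrow> real"
  assumes f: "bounded_linear f" and "0 < \<epsilon>"
  shows "\<exists>n. \<forall>x. (\<forall>i<n. james_seq x i = 0) \<longrightarrow> \<bar>f x\<bar> \<le> \<epsilon> * norm x"
proof (rule ccontr)
  interpret f: bounded_linear f by (rule f)
  assume "\<not> ?thesis"
  then have ex: "\<exists>x. (\<forall>i<n. james_seq x i = 0) \<and> \<epsilon> * norm x < \<bar>f x\<bar>" for n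
    by (meson not_le)
  have "\<exists>x m. (\<forall>i. i < n \<or> m \<le> i \<longrightarrow> james_seq x i = 0) \<and> n \<le> m \<and> (norm x)\<^sup>2 \<le> 9 \<and> \<epsilon> < f x" for n
  proof -
    obtain x where x: "\<And>i. i < n \<Longrightarrow> james_seq x i = 0" and fx: "\<epsilon> * norm x < \<bar>f x\<bar>"
      using ex by blast
    have "x \<noteq> 0" using fx f.zero by auto
    \<comment> \<open>The sign factor makes \<open>f\<close> positive on the block, so that values
      on different blocks add up.\<close>
    define y where "y = (sgn (f x) / norm x) *\<^sub>R x"
    have "norm y \<le> 1" using \<open>x \<noteq> 0\<close> by (simp add: y_def abs_sgn_eq)
    have "f y = \<bar>f x\<bar> / norm x" by (simp add: y_def f.scaleR abs_sgn mult.commute)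
    then have "\<epsilon> < f y" using fx \<open>x \<noteq> 0\<close> by (simp add: pos_less_divide_eq)
    \<comment> \<open>The tails of \<open>y\<close> tend to 0 in norm, so a late cut makes the
      support finite and keeps \<open>f\<close> above \<epsilon>; the norm is then at most 1 +
      2.\<close>
    have "(\<lambda>m. f (y - james_rest m y)) \<longlonglongrightarrow> f (y - 0)"
      by (intro f.tendsto tendsto_intros james_rest_tendsto)
    then have "eventually (\<lambda>m. \<epsilon> < f (y - james_rest m y)) sequentially"
      using \<open>\<epsilon> < f y\<close> by (intro order_tendstoD) auto
    then obtain m where m: "n \<le> m" "\<epsilon> < f (y - james_rest m y)"
      unfolding eventually_sequentially by (meson nle_le)
    have "norm (y - james_rest m y) \<le> norm y + norm (james_rest m y)"
      by (rule norm_triangle_ineq4)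
    then have "norm (y - james_rest m y) \<le> 3"
      using norm_james_rest_le[of m y] \<open>norm y \<le> 1\<close> by simp
    then have "(norm (y - james_rest m y))\<^sup>2 \<le> 3\<^sup>2" by (rule power_mono) simp
    with m x show ?thesis
      by (intro exI[of _ "y - james_rest m y"] exI[of _ m]) (auto simp: y_def)
  qed
  then obtain X M where XM: "\<And>n i. i < n \<or> M n \<le> i \<Longrightarrow> james_seq (X n) i = 0"
    "\<And>n. n \<le> M n" "\<And>n. (norm (X n))\<^sup>2 \<le> 9" "\<And>n. \<epsilon> < f (X n)"
    by metis
  \<comment> \<open>Iterating \<open>M\<close> starts each block where the previous one
    ends.\<close>
  define b where "b k = (M ^^ k) 0" for k
  have b_Suc: "b (Suc k) = M (b k)" for k by (simp add: b_def)
  have b_mono: "b j \<le> b k" if "j \<le> k" for j k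
    by (rule lift_Suc_mono_le[OF _ that]) (simp add: b_Suc XM)
  define z where "z k = X (b k)" for k
  have "james_seq (z m) i = 0 \<or> james_seq (z m') i = 0" if "m < m'" for m m' i
  proof -
    have "M (b m) \<le> b m'" using b_mono[of "Suc m" m'] that by (simp add: b_Suc)
    then show ?thesis unfolding z_def using XM(1)[of i "b m'"] XM(1)[of i "b m"] by linarith
  qed
  then have disj: "james_seq (z m) i = 0 \<or> james_seq (z m') i = 0" if "m \<noteq> m'" for m m' i
    using that by (metis linorder_neqE_nat)
  obtain B where B: "\<And>x. norm (f x) \<le> norm x * B" "0 < B" using f.pos_bounded by blast
  have bound: "real N * \<epsilon>\<^sup>2 \<le> 18 * B\<^sup>2" if "0 < N" for N
  proof -
    have "real N * \<epsilon> = (\<Sum>k<N. \<epsilon>)" by simp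
    also have "\<dots> \<le> (\<Sum>k<N. f (z k))" by (intro sum_mono) (simp add: z_def less_imp_le XM)
    also have "\<dots> = f (\<Sum>k<N. z k)" by (simp add: f.sum)
    also have "\<dots> \<le> norm (\<Sum>k<N. z k) * B" using B(1)[of "\<Sum>k<N. z k"] by simp
    finally have "(real N * \<epsilon>)\<^sup>2 \<le> (norm (\<Sum>k<N. z k) * B)\<^sup>2"
      using \<open>0 < \<epsilon>\<close> by (intro power_mono) auto
    also have "\<dots> = (norm (\<Sum>k<N. z k))\<^sup>2 * B\<^sup>2" by (simp add: power_mult_distrib)
    also have "\<dots> \<le> (2 * (\<Sum>k<N. (norm (z k))\<^sup>2)) * B\<^sup>2"
      by (intro mult_right_mono norm_james_sum_disjoint disj) auto
    also have "\<dots> \<le> (2 * (\<Sum>k<N. 9)) * B\<^sup>2"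
      by (intro mult_right_mono mult_left_mono sum_mono) (auto simp: z_def XM)
    finally have "real N * (real N * \<epsilon>\<^sup>2) \<le> real N * (18 * B\<^sup>2)"
      by (simp add: power2_eq_square algebra_simps)
    then show ?thesis using that by simp
  qed
  obtain N where N: "18 * B\<^sup>2 < real N * \<epsilon>\<^sup>2"
    using reals_Archimedean3[of "\<epsilon>\<^sup>2"] \<open>0 < \<epsilon>\<close> by auto
  then have "0 < N" using B(2) by (cases N) auto
  from bound[OF this] N show False by simp
qed

section \<open>The weak topology\<close>

lemma weak_topspace [simp]: "topspace (weak_topology smul) = UNIV"
proof -
  have "(\<lambda>_. 0) \<in> dual_space smul" by (simp add: dual_space_def)
  then have "UNIV \<in> {f -` U | f U. f \<in> dual_space smul \<and> open U}" by force
  then show ?thesis unfolding weak_topology_def topology_generated_by_topspace by blast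
qed

lemma openin_weak: "f \<in> dual_space smul \<Longrightarrow> open U \<Longrightarrow> openin (weak_topology smul) (f -` U)"
  unfolding weak_topology_def by (rule topology_generated_by_Basis) blast

abbreviation "james_weak \<equiv> weak_topology ((*\<^sub>R) :: real \<Rightarrow> james \<Rightarrow> james)"

lemma dual_space_james: "dual_space ((*\<^sub>R) :: real \<Rightarrow> james \<Rightarrow> james) = {f. bounded_linear f}"
  by (auto simp: dual_space_def bounded_linear_def linear_cmul)

lemma openin_james_weak_seq: "open U \<Longrightarrow> openin james_weak {x. james_seq x i \<in> U}"
  using openin_weak[of "\<lambda>x. james_seq x i" "(*\<^sub>R)" U]
  by (simp add: dual_space_james bounded_linear_james_seq vimage_def)

lemma Hausdorff_james_weak: "Hausdorff_space james_weak"
  unfolding Hausdorff_space_def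
proof (intro allI impI)
  fix x y :: james
  assume "x \<in> topspace james_weak \<and> y \<in> topspace james_weak \<and> x \<noteq> y"
  then obtain i where "james_seq x i \<noteq> james_seq y i" by (auto simp: james_eq_iff)
  then obtain U V where "open U" "open V" "james_seq x i \<in> U" "james_seq y i \<in> V" "U \<inter> V = {}"
    using hausdorff[of "james_seq x i" "james_seq y i"] by blast
  then show "\<exists>U V. openin james_weak U \<and> openin james_weak V \<and> x \<in> U \<and> y \<in> V \<and> disjnt U V"
    by (intro exI[of _ "{x. james_seq x i \<in> U}"] exI[of _ "{x. james_seq x i \<in> V}"])
      (auto simp: openin_james_weak_seq disjnt_def)
qed

text \<open>As the basis is shrinking, a functional is on bounded sets a uniform limit of finite
  combinations of coordinates.\<close>

lemma bounded_linear_james_comp_continuous_on: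
  assumes f: "bounded_linear (f :: james \<Rightarrow> real)"
    and K: "\<And>y. y \<in> K \<Longrightarrow> james_bound y c \<and> y \<longlonglongrightarrow> 0"
  shows "continuous_on K (\<lambda>y. f (Abs_james y))"
proof -
  interpret f: bounded_linear f by (rule f)
  let ?g = "\<lambda>n y. \<Sum>k<n. y k * f (james_unit k)"
  have "uniform_limit K ?g (\<lambda>y. f (Abs_james y)) sequentially"
  proof (rule uniform_limitI)
    fix e :: real assume "0 < e"
    \<comment> \<open>Leaves room for the factor 2 of \<open>norm_james_rest_le\<close> and for the
      norm bound \<open>c\<close>; the summand 1 covers \<open>c = 0\<close>.\<close>
    define d where "d = e / (2 * (\<bar>c\<bar> + 1))"
    have "0 < d" using \<open>0 < e\<close> by (simp add: d_def)
    have "2 * d * \<bar>c\<bar> < e"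
      using \<open>0 < e\<close> by (simp add: d_def field_simps)
    obtain n where n: "\<And>x. (\<And>i. i < n \<Longrightarrow> james_seq x i = 0) \<Longrightarrow> \<bar>f x\<bar> \<le> d * norm x"
      using james_basis_shrinking[OF f \<open>0 < d\<close>] by blast
    have "dist (?g m y) (f (Abs_james y)) < e" if "n \<le> m" "y \<in> K" for m y
    proof -
      let ?x = "Abs_james y"
      have seq: "james_seq ?x = y" using K[OF that(2)] james_seq_Abs by blast
      have "f (?x - james_rest m ?x) = ?g m y"
        unfolding james_minus_rest by (simp add: f.sum f.scaleR seq)
      then have "dist (?g m y) (f ?x) = \<bar>f (james_rest m ?x)\<bar>"
        by (simp add: f.diff dist_real_def)
      also have "\<dots> \<le> d * norm (james_rest m ?x)" using that(1) by (intro n) simp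
      also have "\<dots> \<le> d * (2 * norm ?x)"
        using \<open>0 < d\<close> norm_james_rest_le by (intro mult_left_mono) auto
      also have "\<dots> \<le> d * (2 * \<bar>c\<bar>)"
        using \<open>0 < d\<close> K[OF that(2)] norm_Abs_james_le[of y c] by (intro mult_left_mono) auto
      finally show ?thesis using \<open>2 * d * \<bar>c\<bar> < e\<close> by simp
    qed
    then show "\<forall>\<^sub>F m in sequentially. \<forall>y\<in>K. dist (?g m y) (f (Abs_james y)) < e"
      unfolding eventually_sequentially by blast
  qed
  moreover have "continuous_on K (?g n)" for n
    by (intro continuous_intros continuous_on_subset[OF continuous_on_product_coordinates]) auto
  ultimately show ?thesis
    by (intro uniform_limit_theorem[where F = sequentially]) auto
qed

lemma weakly_compact_Abs_james:
  assumes "compact K" and K: "\<And>y. y \<in> K \<Longrightarrow> james_bound y c \<and> y \<longlonglongrightarrow> 0"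
  shows "compactin james_weak (Abs_james ` K)"
proof -
  have "continuous_map (top_of_set K) james_weak Abs_james"
    unfolding weak_topology_def
  proof (rule continuous_on_generated_topo)
    fix W assume "W \<in> {f -` U | f U. f \<in> dual_space ((*\<^sub>R) :: real \<Rightarrow> james \<Rightarrow> james) \<and> open U}"
    then obtain f U where W: "W = f -` U" and dual: "f \<in> dual_space ((*\<^sub>R) :: real \<Rightarrow> james \<Rightarrow> james)"
      and "open U"
      by blast
    from dual have f: "bounded_linear f" by (simp add: dual_space_james)
    from bounded_linear_james_comp_continuous_on[where K = K, OF f K] \<open>open U\<close>
    have "openin (top_of_set K) (K \<inter> (\<lambda>y. f (Abs_james y)) -` U)"
      by (intro continuous_openin_preimage_gen)
    moreover have "K \<inter> (\<lambda>y. f (Abs_james y)) -` U = Abs_james -` W \<inter> topspace (top_of_set K)"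
      by (auto simp: W)
    ultimately show "openin (top_of_set K) (Abs_james -` W \<inter> topspace (top_of_set K))" by simp
  next
    show "Abs_james ` topspace (top_of_set K)
        \<subseteq> \<Union> {f -` U | f U. f \<in> dual_space ((*\<^sub>R) :: real \<Rightarrow> james \<Rightarrow> james) \<and> open U}"
      using weak_topspace[of "(*\<^sub>R) :: real \<Rightarrow> james \<Rightarrow> james"]
      unfolding weak_topology_def topology_generated_by_topspace by (simp only: subset_UNIV)
  qed
  moreover have "compactin (top_of_set K) K"
    using \<open>compact K\<close> by (simp add: compactin_subtopology)
  ultimately show ?thesis using image_compactin by blast
qed

text \<open>Each inequality in \<open>james_bound\<close> is a closed condition on finitely many
  coordinates; the limit 0 bounds all coordinates by \<open>c\<close>, and Tychonoff's theorem
  applies.\<close>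

lemma compact_james_bound:
  assumes "closed A" "\<And>y. y \<in> A \<Longrightarrow> james_bound y c \<Longrightarrow> y \<longlonglongrightarrow> 0"
  shows "compact {y \<in> A. james_bound y c}"
proof -
  have cont: "continuous_on UNIV (\<lambda>y::nat \<Rightarrow> real. L2_set (\<lambda>j. y (p (Suc j)) - y (p j)) {..<n})" for n p
    unfolding L2_set_def by (intro continuous_intros continuous_on_product_coordinates)
  have "closed ({y. james_bound y c})"
  proof (cases "0 \<le> c")
    case True
    then have "{y. james_bound y c} =
      (\<Inter>n. \<Inter>p\<in>{p. strict_mono_on {..n} p}. {y. L2_set (\<lambda>j. y (p (Suc j)) - y (p j)) {..<n} \<le> c})"
      by (auto simp: james_bound_def)
    also have "closed \<dots>"
      by (intro closed_INT ballI closed_Collect_le cont continuous_on_const)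
    finally show ?thesis .
  qed (simp add: james_bound_def)
  then have "closed (A \<inter> {y. james_bound y c})" using assms(1) by (rule closed_Int[rotated])
  moreover have "compact (PiE UNIV (\<lambda>_::nat. {-c..c}))"
    using compactin_PiE[of "\<lambda>_. euclidean :: real topology" UNIV "\<lambda>_::nat. {-c..c}"]
    by (simp add: euclidean_product_topology)
  moreover have "A \<inter> {y. james_bound y c} \<subseteq> PiE UNIV (\<lambda>_::nat. {-c..c})"
  proof
    fix y assume "y \<in> A \<inter> {y. james_bound y c}"
    then have "\<bar>y i\<bar> \<le> c" for i using assms(2) by (auto intro: james_bound_coord)
    then show "y \<in> PiE UNIV (\<lambda>_::nat. {-c..c})" by (auto simp: abs_le_iff minus_le_iff)
  qed
  ultimately have "compact (PiE UNIV (\<lambda>_::nat. {-c..c}) \<inter> (A \<inter> {y. james_bound y c}))"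
    by (intro compact_Int_closed)
  then show ?thesis
    using \<open>A \<inter> {y. james_bound y c} \<subseteq> PiE UNIV (\<lambda>_::nat. {-c..c})\<close>
    by (simp add: Int_absorb1 Collect_conj_eq)
qed

lemma variation_cong: "(\<And>i. i \<in> set l \<Longrightarrow> x i = y i) \<Longrightarrow> variation x l = variation y l"
  by (induction l rule: induct_list012) auto

section \<open>Block averages\<close>

text \<open>Lists rather than sets: the gliding hump may select a coordinate several times, and
  repetitions act as weights.\<close>

definition list_avg :: "('a \<Rightarrow> real) \<Rightarrow> 'a list \<Rightarrow> real"
  where "list_avg x l = (\<Sum>j\<leftarrow>l. x j) / real (length l)"

lemma list_avg_add: "list_avg (\<lambda>j. x j + y j) l = list_avg x l + list_avg y l"
  by (simp add: list_avg_def sum_list_addf add_divide_distrib)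

lemma list_avg_mult: "list_avg (\<lambda>j. r * x j) l = r * list_avg x l"
  by (simp add: list_avg_def sum_list_const_mult)

lemma list_avg_const: "l \<noteq> [] \<Longrightarrow> list_avg (\<lambda>_. r) l = r"
  by (simp add: list_avg_def sum_list_triv)

lemma list_avg_cong: "(\<And>j. j \<in> set l \<Longrightarrow> x j = y j) \<Longrightarrow> list_avg x l = list_avg y l"
  unfolding list_avg_def by (metis (mono_tags, lifting) map_eq_conv)

lemma abs_list_avg_le:
  assumes "l \<noteq> []" "\<And>j. j \<in> set l \<Longrightarrow> \<bar>x j\<bar> \<le> e"
  shows "\<bar>list_avg x l\<bar> \<le> e"
proof -
  have "\<bar>\<Sum>j\<leftarrow>l. x j\<bar> \<le> (\<Sum>j\<leftarrow>l. \<bar>x j\<bar>)" using sum_list_abs[of "map x l"] by (simp add: comp_def)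
  also have "\<dots> \<le> (\<Sum>j\<leftarrow>l. e)" by (rule sum_list_mono) (rule assms(2))
  finally show ?thesis using assms(1) by (simp add: list_avg_def sum_list_triv field_simps)
qed

text \<open>For fixed \<open>c\<close>, the sequences satisfying the bound form a convex
  set.\<close>

lemma james_bound_list_avg:
  assumes "l \<noteq> []" "\<And>j. j \<in> set l \<Longrightarrow> james_bound (z j) c"
  shows "james_bound (\<lambda>i. list_avg (\<lambda>j. z j i) l) c"
proof -
  have "james_bound (\<lambda>i. \<Sum>j\<leftarrow>l. z j i) (real (length l) * c)"
    using assms(2)
  proof (induction l)
    case Nil
    then show ?case by (simp add: james_bound_def L2_set_def)
  next
    case (Cons a l)
    then show ?case
      using james_bound_add[of "z a" c "\<lambda>i. \<Sum>j\<leftarrow>l. z j i" "real (length l) * c"]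
      by (simp add: algebra_simps)
  qed
  from james_bound_scale[OF this, of "1 / real (length l)"] show ?thesis
    using assms(1) by (simp add: list_avg_def)
qed

lemma james_bound_geometric:
  assumes "\<And>k. \<bar>\<alpha> k\<bar> \<le> \<eta> / 2 ^ k"
  shows "james_bound \<alpha> (2 * \<eta>)"
proof (rule james_boundI)
  show "0 \<le> 2 * \<eta>" using assms[of 0] by simp
  fix l :: "nat list" assume "sorted l"
  \<comment> \<open>The constant 3 reproduces itself: in units of
    \<open>\<eta>\<^sup>2 / 4 ^ a\<close>, a jump from \<open>a\<close> costs at most 9/4 and the
    rest of the list, starting at \<open>a + 1\<close> or later, at most 3/4.\<close>
  then have "variation \<alpha> l \<le> 3 * \<eta>\<^sup>2 / 4 ^ (hd l)"
  proof (induction l rule: induct_list012)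
    case (3 a b l)
    show ?case
    proof (cases "a = b")
      case False
      then have "Suc a \<le> b" using 3(3) by simp
      then have pow: "(2::real) * 2 ^ a \<le> 2 ^ b" "(4::real) * 4 ^ a \<le> 4 ^ b"
        using power_increasing[of "Suc a" b "2::real"] power_increasing[of "Suc a" b "4::real"]
        by simp_all
      have "0 \<le> \<eta>" using assms[of 0] by simp
      have "\<eta> / 2 ^ b \<le> \<eta> / (2 * 2 ^ a)"
        using pow \<open>0 \<le> \<eta>\<close> by (intro divide_left_mono) auto
      then have "\<bar>\<alpha> b - \<alpha> a\<bar> \<le> 3 / 2 * \<eta> / 2 ^ a"
      proof -
        have "\<bar>\<alpha> b - \<alpha> a\<bar> \<le> \<eta> / 2 ^ a + \<eta> / (2 * 2 ^ a)"
          using assms[of a] assms[of b] \<open>\<eta> / 2 ^ b \<le> \<eta> / (2 * 2 ^ a)\<close> by linarith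
        then show ?thesis by (simp add: field_simps)
      qed
      then have "\<bar>\<alpha> b - \<alpha> a\<bar>\<^sup>2 \<le> (3 / 2 * \<eta> / 2 ^ a)\<^sup>2" by (rule power_mono) simp
      also have "\<dots> = 9 / 4 * \<eta>\<^sup>2 / 4 ^ a"
      proof -
        have "(2 ^ a)\<^sup>2 = (4::real) ^ a" by (simp add: power2_eq_square flip: power_mult_distrib)
        then show ?thesis by (simp add: power_divide power_mult_distrib)
      qed
      finally have "(\<alpha> b - \<alpha> a)\<^sup>2 \<le> 9 / 4 * \<eta>\<^sup>2 / 4 ^ a" by simp
      moreover have "variation \<alpha> (b # l) \<le> 3 * \<eta>\<^sup>2 / 4 ^ b" using 3 by simp
      moreover have "3 * \<eta>\<^sup>2 / 4 ^ b \<le> 3 * \<eta>\<^sup>2 / (4 * 4 ^ a)"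
        using pow by (intro divide_left_mono) auto
      ultimately have "(\<alpha> b - \<alpha> a)\<^sup>2 + variation \<alpha> (b # l)
          \<le> 9 / 4 * \<eta>\<^sup>2 / 4 ^ a + 3 * \<eta>\<^sup>2 / (4 * 4 ^ a)"
        by linarith
      also have "\<dots> = 3 * \<eta>\<^sup>2 / 4 ^ a" by (simp add: field_simps)
      finally show ?thesis by simp
    qed (use 3 in auto)
  qed auto
  also have "\<dots> \<le> 3 * \<eta>\<^sup>2 / 1" by (intro divide_left_mono) auto
  also have "\<dots> \<le> (2 * \<eta>)\<^sup>2" by (simp add: power_mult_distrib)
  finally show "variation \<alpha> l \<le> (2 * \<eta>)\<^sup>2" .
qed

text \<open>Block \<open>k\<close> is the preimage of \<open>k\<close> under \<kappa>, an interval
  by monotonicity; \<open>L k\<close> lists the coordinates in it that are averaged.\<close>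

locale index_blocks =
  fixes \<kappa> :: "nat \<Rightarrow> nat" and L :: "nat \<Rightarrow> nat list"
  assumes mono_\<kappa>: "mono \<kappa>"
    and L_nonempty: "L k \<noteq> []"
    and \<kappa>_L: "j \<in> set (L k) \<Longrightarrow> \<kappa> j = k"
begin

lemma \<kappa>_section: "\<kappa> (hd (L k)) = k"
  using \<kappa>_L L_nonempty by (meson hd_in_set)

lemma \<kappa>_at_top: "filterlim \<kappa> at_top sequentially"
proof (subst filterlim_at_top, intro allI)
  fix k
  have "k \<le> \<kappa> i" if "hd (L k) \<le> i" for i
    using monoD[OF mono_\<kappa> that] by (simp add: \<kappa>_section)
  then show "eventually (\<lambda>i. k \<le> \<kappa> i) sequentially" by (rule eventually_sequentiallyI)
qed

text \<open>Monotonicity of \<kappa> forces all entries of \<open>L k\<close> beyond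
  \<open>n\<close> once \<open>k\<close> exceeds \<open>\<kappa> n\<close>.\<close>

lemma block_avg_tendsto:
  assumes "x \<longlonglongrightarrow> a"
  shows "(\<lambda>k. list_avg x (L k)) \<longlonglongrightarrow> a"
proof (rule LIMSEQ_I)
  fix e :: real assume "0 < e"
  then obtain n where n: "\<And>i. n \<le> i \<Longrightarrow> \<bar>x i - a\<bar> < e / 2"
    using LIMSEQ_D[OF assms, of "e / 2"] by auto
  have "norm (list_avg x (L k) - a) < e" if "Suc (\<kappa> n) \<le> k" for k
  proof -
    have "n \<le> j" if "j \<in> set (L k)" for j
      using \<kappa>_L[OF that] \<open>Suc (\<kappa> n) \<le> k\<close> monoD[OF mono_\<kappa>, of j n] by (cases "n \<le> j") auto
    then have "\<bar>list_avg (\<lambda>j. x j + - a) (L k)\<bar> \<le> e / 2"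
      using n by (intro abs_list_avg_le[OF L_nonempty]) (simp add: less_imp_le)
    then have "\<bar>list_avg x (L k) - a\<bar> \<le> e / 2"
      by (simp only: list_avg_add list_avg_const[OF L_nonempty] diff_conv_add_uminus)
    then show ?thesis using \<open>0 < e\<close> by simp
  qed
  then show "\<exists>no. \<forall>k\<ge>no. norm (list_avg x (L k) - a) < e" by blast
qed

text \<open>Replacing the averages by values one block at a time exhibits the averaged sequence as an
  iterated convex combination of the sequences \<open>x \<circ> \<phi> \<circ> \<kappa>\<close>.\<close>

lemma james_bound_block_avg:
  assumes x: "james_bound x c"
  shows "james_bound (\<lambda>i. list_avg x (L (\<kappa> i))) c"
proof -
  \<comment> \<open>The first \<open>K\<close> blocks carry their averages, the later ones a sample
    of \<open>x\<close> chosen by \<phi>.\<close>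
  define R where "R = (\<lambda>K \<phi> i. if \<kappa> i < K then list_avg x (L (\<kappa> i)) else x (\<phi> (\<kappa> i)))"
  have R: "james_bound (R K \<phi>) c" if "\<And>k. \<kappa> (\<phi> k) = k" for K \<phi>
    using that
  proof (induction K arbitrary: \<phi>)
    case 0
    \<comment> \<open>A section of a monotone map is monotone, so the sampled sequence is a monotone
      reindexing of \<open>x\<close>.\<close>
    have "\<phi> k \<le> \<phi> k'" if "k \<le> k'" for k k'
      using monoD[OF mono_\<kappa>, of "\<phi> k'" "\<phi> k"] 0 that by (metis le_antisym nle_le)
    then have "mono (\<lambda>i. \<phi> (\<kappa> i))" using mono_\<kappa> by (simp add: mono_def)
    then show ?case using james_bound_comp_mono[OF x] by (simp add: R_def)
  next
    case (Suc K)
    \<comment> \<open>Outside block \<open>K\<close> equal values are averaged; on block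
      \<open>K\<close> the samples range over \<open>L K\<close> and yield the block
      average.\<close>
    have "R (Suc K) \<phi> = (\<lambda>i. list_avg (\<lambda>j. R K (\<phi>(K := j)) i) (L K))"
      by (rule ext) (auto simp: R_def less_Suc_eq list_avg_const L_nonempty)
    moreover have "james_bound (\<lambda>i. list_avg (\<lambda>j. R K (\<phi>(K := j)) i) (L K)) c"
      using Suc.prems by (intro james_bound_list_avg[OF L_nonempty] Suc.IH) (auto simp: \<kappa>_L)
    ultimately show ?case by simp
  qed
  show ?thesis
  proof (rule james_boundI[OF james_bound_nonneg[OF x]])
    fix l :: "nat list" assume "sorted l"
    \<comment> \<open>Only finitely many blocks meet the list, so finitely many replacements
      suffice.\<close>
    define K where "K = Suc (Max (\<kappa> ` set l))"
    have "variation (\<lambda>i. list_avg x (L (\<kappa> i))) l = variation (R K (\<lambda>k. hd (L k))) l"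
      by (rule variation_cong) (simp add: R_def K_def less_Suc_eq_le)
    also have "\<dots> \<le> c\<^sup>2"
      using R[of "\<lambda>k. hd (L k)" K] \<open>sorted l\<close> by (simp add: \<kappa>_section james_boundD)
    finally show "variation (\<lambda>i. list_avg x (L (\<kappa> i))) l \<le> c\<^sup>2" .
  qed
qed

definition avg_op :: "james \<Rightarrow> james"
  where "avg_op x = Abs_james (\<lambda>i. list_avg (james_seq x) (L (\<kappa> i)))"

lemma james_seq_avg_op [simp]: "james_seq (avg_op x) = (\<lambda>i. list_avg (james_seq x) (L (\<kappa> i)))"
  unfolding avg_op_def
  by (rule james_seq_Abs[OF filterlim_compose[OF block_avg_tendsto[OF james_seq_tendsto] \<kappa>_at_top]
        james_bound_block_avg[OF james_bound_norm]])

lemma norm_avg_op_le: "norm (avg_op x) \<le> norm x"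
  by (rule norm_james_le) (simp add: james_bound_block_avg james_bound_norm)

lemma bounded_linear_avg_op: "bounded_linear avg_op"
  by (rule bounded_linear_intro[where K = 1])
    (auto simp: james_eq_iff list_avg_add list_avg_mult norm_avg_op_le)

definition osc_op :: "james \<Rightarrow>\<^sub>L james"
  where "osc_op = Blinfun (\<lambda>x. x - avg_op x)"

lemma osc_op_apply [simp]: "blinfun_apply osc_op x = x - avg_op x"
  unfolding osc_op_def
  by (simp add: bounded_linear_Blinfun_apply bounded_linear_sub bounded_linear_ident bounded_linear_avg_op)

lemma norm_osc_op_apply_le: "norm (x - avg_op x) \<le> 2 * norm x"
  using norm_triangle_ineq4[of x "avg_op x"] norm_avg_op_le[of x] by simp

lemma norm_osc_op_le: "norm osc_op \<le> 2"
  by (rule norm_blinfun_bound) (simp_all add: norm_osc_op_apply_le)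

text \<open>A sequence of finite variation converges, and its limit is 0 if all block averages vanish;
  so no mass escapes to infinity in coordinatewise limits of such sequences.\<close>

lemma osc_op_weakly_compact: "osc_op \<in> weakly_compact_operators (*\<^sub>R)"
proof -
  define A where "A = {y. \<forall>k. list_avg y (L k) = 0}"
  define K where "K = {y \<in> A. james_bound y 2}"
  have lim: "y \<longlonglongrightarrow> 0" if yA: "y \<in> A" and yc: "james_bound y c" for y c
  proof -
    obtain a where a: "y \<longlonglongrightarrow> a"
      using james_bound_convergent[OF yc] by (auto simp: convergent_def)
    from block_avg_tendsto[OF a] yA have "a = 0"
      by (simp add: A_def LIMSEQ_const_iff)
    with a show ?thesis by simp
  qed
  have "A = (\<Inter>k. {y. list_avg y (L k) = 0})" by (auto simp: A_def)
  moreover have "continuous_on UNIV (\<lambda>y. list_avg y l)" for l :: "nat list"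
  proof -
    have "continuous_on UNIV (\<lambda>y. \<Sum>j\<leftarrow>l. (y j :: real))"
      by (induction l) (auto intro!: continuous_intros)
    then show ?thesis unfolding list_avg_def divide_inverse by (intro continuous_intros)
  qed
  ultimately have "closed A"
    by (simp add: closed_INT closed_Collect_eq)
  then have "compact K" unfolding K_def using lim by (rule compact_james_bound)
  then have cpt: "compactin james_weak (Abs_james ` K)"
    by (rule weakly_compact_Abs_james[where c = 2]) (auto simp: K_def lim)
  have "osc_op ` cball 0 1 \<subseteq> Abs_james ` K"
  proof
    fix y assume "y \<in> osc_op ` cball 0 1"
    then obtain x where x: "norm x \<le> 1" and y: "y = x - avg_op x" by auto
    have "norm y \<le> 2" using norm_osc_op_apply_le[of x] x y by simp
    then have "james_bound (james_seq y) 2" by (rule james_bound_weaken[OF james_bound_norm])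
    \<comment> \<open>On block \<open>k\<close>, \<open>avg_op x\<close> is constantly the average
      of \<open>x\<close> over \<open>L k\<close>, so the difference averages to 0.\<close>
    moreover have "list_avg (james_seq y) (L k) = 0" for k
    proof -
      have "list_avg (james_seq y) (L k)
          = list_avg (\<lambda>j. james_seq x j + - list_avg (james_seq x) (L k)) (L k)"
        by (rule list_avg_cong) (simp add: y \<kappa>_L)
      also have "\<dots> = 0"
        using L_nonempty by (simp add: list_avg_add list_avg_const del: add_uminus_conv_diff)
      finally show ?thesis .
    qed
    ultimately have "james_seq y \<in> K" by (simp add: K_def A_def)
    then show "y \<in> Abs_james ` K" by (metis imageI james_seq_inverse)
  qed
  \<comment> \<open>A compact set in a Hausdorff topology is closed, so it contains the weak closure
    of the image of the ball.\<close>
  moreover have "closedin james_weak (Abs_james ` K)"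
    using cpt Hausdorff_james_weak by (simp add: compactin_imp_closedin)
  ultimately have "james_weak closure_of (osc_op ` cball 0 1) \<subseteq> Abs_james ` K"
    by (rule closure_of_minimal)
  then have "compactin james_weak (james_weak closure_of (osc_op ` cball 0 1))"
    by (rule closed_compactin[OF cpt _ closedin_closure_of])
  then show ?thesis
    by (simp add: weakly_compact_operators_def blinfun.scaleR_right del: osc_op_apply)
qed

end

section \<open>Small averages of coordinate functionals\<close>

text \<open>Subtracting the right end value leaves only the oscillation of \<open>x\<close>, so the
  norm is controlled by the variation between \<open>m\<close> and \<open>n\<close>.\<close>

definition james_window :: "nat \<Rightarrow> nat \<Rightarrow> james \<Rightarrow> james"
  where "james_window m n x =
    Abs_james (\<lambda>i. if m \<le> i \<and> i < n then james_seq x i - james_seq x n else 0)"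

lemma james_window:
  assumes "m \<le> n"
  shows james_seq_window: "james_seq (james_window m n x) =
      (\<lambda>i. if m \<le> i \<and> i < n then james_seq x i - james_seq x n else 0)"
    and norm_james_window_le: "0 \<le> c \<Longrightarrow>
      (\<And>l. sorted l \<Longrightarrow> set l \<subseteq> {m..n} \<Longrightarrow> variation (james_seq x) l \<le> c\<^sup>2) \<Longrightarrow>
      norm (james_window m n x) \<le> 2 * c"
proof -
  have lim: "(\<lambda>i. if m \<le> i \<and> i < n then james_seq x i - james_seq x n else 0) \<longlonglongrightarrow> 0"
    by (rule Lim_transform_eventually[OF tendsto_const])
      (auto simp: eventually_sequentially intro!: exI[of _ n])
  show "james_seq (james_window m n x) =
      (\<lambda>i. if m \<le> i \<and> i < n then james_seq x i - james_seq x n else 0)"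
    unfolding james_window_def
    by (rule james_seq_Abs[OF lim james_bound_window[OF assms norm_ge_zero[of x]]])
      (rule variation_le_norm)
  show "norm (james_window m n x) \<le> 2 * c"
    if "0 \<le> c" "\<And>l. sorted l \<Longrightarrow> set l \<subseteq> {m..n} \<Longrightarrow> variation (james_seq x) l \<le> c\<^sup>2"
    unfolding james_window_def
    by (rule norm_Abs_james_le[OF james_bound_window[OF assms that] lim])
qed

text \<open>Otherwise \<open>norm_james_window_le\<close> with \<open>c\<close> a quarter of the
  window norm would bound that norm by half of itself.\<close>

lemma james_window_variation:
  assumes "m \<le> n"
  shows "\<exists>l. sorted l \<and> set l \<subseteq> {m..n} \<and> (norm (james_window m n x))\<^sup>2 \<le> 16 * variation (james_seq x) l"
proof (rule ccontr)
  let ?r = "norm (james_window m n x)"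
  assume "\<not> ?thesis"
  then have *: "16 * variation (james_seq x) l < ?r\<^sup>2" if "sorted l" "set l \<subseteq> {m..n}" for l
    using that by (meson not_le)
  have "0 < ?r" using *[of "[]"] by simp
  have "?r \<le> 2 * (?r / 4)"
  proof (rule norm_james_window_le[OF assms])
    show "variation (james_seq x) l \<le> (?r / 4)\<^sup>2" if "sorted l" "set l \<subseteq> {m..n}" for l
      using *[OF that] by (simp add: power_divide)
  qed simp
  with \<open>0 < ?r\<close> show False by simp
qed

text \<open>Lists for successive windows concatenate to one sorted list, so the squared window norms
  sum to at most \<open>16 * (norm x)\<^sup>2\<close>; Cauchy-Schwarz gives
  \<open>sqrt N\<close>.\<close>

lemma sum_norm_james_windows_le:
  assumes b: "\<And>k. b k \<le> b (Suc k)"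
  shows "(\<Sum>j<N. norm (james_window (b j) (b (Suc j)) x)) \<le> 4 * sqrt N * norm x"
proof -
  let ?w = "\<lambda>j. norm (james_window (b j) (b (Suc j)) x)"
  obtain l where l: "\<And>j. sorted (l j)" "\<And>j. set (l j) \<subseteq> {b j..b (Suc j)}"
    "\<And>j. (?w j)\<^sup>2 \<le> 16 * variation (james_seq x) (l j)"
    using james_window_variation[OF b, where x = x] by metis
  \<comment> \<open>The bound \<open>b N\<close> on the entries keeps the concatenation sorted in
    the induction step.\<close>
  have "sorted (concat (map l [0..<N])) \<and> set (concat (map l [0..<N])) \<subseteq> {..b N} \<and>
      (\<Sum>j<N. variation (james_seq x) (l j)) \<le> variation (james_seq x) (concat (map l [0..<N]))"
  proof (induction N)
    case (Suc N)
    have "sorted (concat (map l [0..<N]) @ l N)"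
      using Suc l(1)[of N] l(2)[of N] by (fastforce simp: sorted_append)
    moreover have "set (concat (map l [0..<N]) @ l N) \<subseteq> {..b (Suc N)}"
      using Suc l(2)[of N] b[of N] by fastforce
    ultimately show ?case
      using Suc variation_append[of "james_seq x" "concat (map l [0..<N])" "l N"] by simp
  qed auto
  then have "(\<Sum>j<N. variation (james_seq x) (l j)) \<le> (norm x)\<^sup>2"
    using variation_le_norm by (meson order_trans)
  moreover have "(\<Sum>j<N. (?w j)\<^sup>2) \<le> 16 * (\<Sum>j<N. variation (james_seq x) (l j))"
    unfolding sum_distrib_left by (intro sum_mono l)
  ultimately have "(\<Sum>j<N. (?w j)\<^sup>2) \<le> 16 * (norm x)\<^sup>2" by simp
  then have "(\<Sum>j<N. (?w j)\<^sup>2) * N \<le> 16 * (norm x)\<^sup>2 * N" by (rule mult_right_mono) simp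
  then have "(\<Sum>j<N. ?w j)\<^sup>2 \<le> 16 * (norm x)\<^sup>2 * N"
    using sum_squared_le_sum_of_squares[of ?w "{..<N}"] by simp
  also have "\<dots> = (4 * sqrt N * norm x)\<^sup>2" by (simp add: power_mult_distrib)
  finally show ?thesis by (rule power2_le_imp_le) simp
qed

text \<open>\<open>z\<close> plays the role of the value of the bidual of \<open>T\<close> at the constant sequence 1, the weak*
  limit of \<open>james_ones\<close>.  For weakly compact \<open>T\<close> it is an element of James' space.\<close>

definition null_at_ones :: "(james \<Rightarrow>\<^sub>L james) \<Rightarrow> bool"
  where "null_at_ones T \<longleftrightarrow> (\<exists>z. z \<longlonglongrightarrow> 0 \<and>
    (\<forall>i n. \<forall>\<delta>>0. \<exists>m\<ge>n. \<bar>james_seq (blinfun_apply T (james_ones m)) i - z i\<bar> < \<delta>))"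

text \<open>The images of \<open>james_ones\<close> lie in a weakly compact set and have a weak
  cluster point, whose coordinates serve as \<open>z\<close>. Since it is only a cluster point,
  \<open>null_at_ones\<close> asks for some \<open>m\<close> beyond each \<open>n\<close>.\<close>

lemma weakly_compact_null_at_ones:
  assumes "T \<in> weakly_compact_operators (*\<^sub>R)"
  shows "null_at_ones T"
proof -
  let ?K = "james_weak closure_of (T ` cball 0 1)"
  have cpt: "compactin james_weak ?K"
    using assms by (simp add: weakly_compact_operators_def)
  have TK: "T (james_ones m) \<in> ?K" for m
    using closure_of_subset[of "T ` cball 0 1" james_weak] norm_james_ones_le[of m] by auto
  \<comment> \<open>Otherwise finitely many open sets cover the compact set, each missing all late
    terms of a sequence inside it.\<close>
  have "\<exists>w. \<forall>U. openin james_weak U \<longrightarrow> w \<in> U \<longrightarrow> (\<forall>n. \<exists>m\<ge>n. T (james_ones m) \<in> U)"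
  proof (rule ccontr)
    assume neg: "\<not> ?thesis"
    let ?C = "{U. openin james_weak U \<and> (\<exists>n. \<forall>m\<ge>n. T (james_ones m) \<notin> U)}"
    have "?K \<subseteq> \<Union>?C" using neg by fastforce
    then obtain F where F: "finite F" "F \<subseteq> ?C" "?K \<subseteq> \<Union>F"
      using compactinD[OF cpt, of ?C] by auto
    have "eventually (\<lambda>m. \<forall>U\<in>F. T (james_ones m) \<notin> U) sequentially"
      using F by (intro eventually_ball_finite) (auto simp: eventually_sequentially)
    then obtain m where "\<forall>U\<in>F. T (james_ones m) \<notin> U" by (auto simp: eventually_sequentially)
    then show False using TK[of m] F(3) by blast
  qed
  then obtain w where w: "\<And>U n. openin james_weak U \<Longrightarrow> w \<in> U \<Longrightarrow> \<exists>m\<ge>n. T (james_ones m) \<in> U"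
    by blast
  have "\<exists>m\<ge>n. \<bar>james_seq (blinfun_apply T (james_ones m)) i - james_seq w i\<bar> < \<delta>" if "0 < \<delta>" for i n \<delta>
    using w[OF openin_james_weak_seq[OF open_ball, of i "james_seq w i" \<delta>], of n] that
    by (auto simp: dist_real_def abs_minus_commute)
  then show ?thesis
    unfolding null_at_ones_def using james_seq_tendsto by blast
qed

text \<open>The sequence of coordinate functionals composed with \<open>T\<close> is weakly null in the dual of
  James' space.  A gliding hump reduces \<open>james_seq (blinfun_apply T x) i\<close> to the part of \<open>x\<close> in the window from
  \<open>n\<close> to \<open>n'\<close>, and there to its oscillation, since \<open>T\<close> nearly annihilates constants.\<close>

lemma null_at_ones_gliding_hump:
  fixes S :: "(james \<Rightarrow>\<^sub>L james) set"
  assumes "finite S" "\<And>T. T \<in> S \<Longrightarrow> null_at_ones T" "0 < \<delta>"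
  shows "\<exists>i n'. b \<le> i \<and> n \<le> n' \<and> (\<forall>T\<in>S. \<forall>x.
    \<bar>james_seq (blinfun_apply T x) i\<bar> \<le> 8 * \<delta> * norm x + norm T * norm (james_window n n' x))"
proof -
  obtain z where z: "\<And>T. T \<in> S \<Longrightarrow> z T \<longlonglongrightarrow> 0"
    "\<And>T i n \<delta>. T \<in> S \<Longrightarrow> 0 < \<delta> \<Longrightarrow> \<exists>m\<ge>n. \<bar>james_seq (blinfun_apply T (james_ones m)) i - z T i\<bar> < \<delta>"
    using assms(2) unfolding null_at_ones_def by metis
  \<comment> \<open>The coordinate \<open>i\<close> is chosen first: the images of finitely many
    unit vectors and \<open>z T\<close> are null sequences.\<close>
  have "eventually (\<lambda>i. \<forall>T\<in>S. (\<Sum>k<n. \<bar>james_seq (blinfun_apply T (james_unit k)) i\<bar>) < \<delta> \<and> \<bar>z T i\<bar> < \<delta>) sequentially"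
  proof (intro eventually_ball_finite[OF assms(1)] ballI eventually_conj)
    fix T assume "T \<in> S"
    have "(\<lambda>i. \<Sum>k<n. \<bar>james_seq (blinfun_apply T (james_unit k)) i\<bar>) \<longlonglongrightarrow> (\<Sum>k<n. 0)"
      by (intro tendsto_sum tendsto_rabs_zero james_seq_tendsto)
    then show "eventually (\<lambda>i. (\<Sum>k<n. \<bar>james_seq (blinfun_apply T (james_unit k)) i\<bar>) < \<delta>) sequentially"
      using \<open>0 < \<delta>\<close> by (intro order_tendstoD) auto
    show "eventually (\<lambda>i. \<bar>z T i\<bar> < \<delta>) sequentially"
      using tendsto_rabs_zero[OF z(1)[OF \<open>T \<in> S\<close>]] \<open>0 < \<delta>\<close> by (intro order_tendstoD) auto
  qed
  then obtain i where i: "b \<le> i"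
    "\<And>T. T \<in> S \<Longrightarrow> (\<Sum>k<n. \<bar>james_seq (blinfun_apply T (james_unit k)) i\<bar>) < \<delta>" "\<And>T. T \<in> S \<Longrightarrow> \<bar>z T i\<bar> < \<delta>"
    unfolding eventually_sequentially by (meson nle_le)
  have lin: "bounded_linear (\<lambda>x. james_seq (blinfun_apply T x) i)" for T
    using bounded_linear_compose[OF bounded_linear_james_seq blinfun.bounded_linear_right] .
  \<comment> \<open>With \<open>i\<close> fixed, the shrinking basis makes the functional small on
    tails, which determines \<open>n'\<close>.\<close>
  have "eventually (\<lambda>n'. \<forall>T\<in>S. \<forall>x. (\<forall>j<n'. james_seq x j = 0) \<longrightarrow>
      \<bar>james_seq (blinfun_apply T x) i\<bar> \<le> \<delta> * norm x) sequentially"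
  proof (intro eventually_ball_finite[OF assms(1)] ballI)
    fix T
    obtain N where "\<forall>x. (\<forall>j<N. james_seq x j = 0) \<longrightarrow> \<bar>james_seq (blinfun_apply T x) i\<bar> \<le> \<delta> * norm x"
      using james_basis_shrinking[OF lin \<open>0 < \<delta>\<close>] by blast
    then show "eventually (\<lambda>n'. \<forall>x. (\<forall>j<n'. james_seq x j = 0) \<longrightarrow>
      \<bar>james_seq (blinfun_apply T x) i\<bar> \<le> \<delta> * norm x) sequentially"
      unfolding eventually_sequentially by (intro exI[of _ N]) auto
  qed
  then obtain n' where n': "n \<le> n'" and tail: "\<And>T x. T \<in> S \<Longrightarrow> (\<And>j. j < n' \<Longrightarrow> james_seq x j = 0) \<Longrightarrow>
      \<bar>james_seq (blinfun_apply T x) i\<bar> \<le> \<delta> * norm x"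
    unfolding eventually_sequentially by (meson nle_le)
  have "\<bar>james_seq (blinfun_apply T x) i\<bar> \<le> 8 * \<delta> * norm x + norm T * norm (james_window n n' x)" if TS: "T \<in> S" for T x
  proof -
    interpret f: bounded_linear "\<lambda>x. james_seq (blinfun_apply T x) i" by (rule lin)
    define f where "f = (\<lambda>x. james_seq (blinfun_apply T x) i)"
    have f_add: "f (x + y) = f x + f y" and f_diff: "f (x - y) = f x - f y"
      and f_scale: "f (r *\<^sub>R x) = r * f x" for x y r
      by (simp_all add: f_def f.add f.diff f.scaleR)
    have head: "\<bar>f (y - james_rest n y)\<bar> \<le> \<delta> * norm y" for y
    proof -
      have "\<bar>f (y - james_rest n y)\<bar> = \<bar>\<Sum>k<n. james_seq y k * f (james_unit k)\<bar>"
        unfolding james_minus_rest by (simp add: f_def f.sum f.scaleR del: james_seq_scaleR)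
      also have "\<dots> \<le> (\<Sum>k<n. norm y * \<bar>f (james_unit k)\<bar>)"
        by (rule order_trans[OF sum_abs])
          (auto simp: abs_mult intro!: sum_mono mult_right_mono abs_james_seq_le_norm)
      also have "\<dots> \<le> norm y * \<delta>"
        unfolding sum_distrib_left[symmetric] using i(2)[OF TS]
        by (intro mult_left_mono) (auto simp: f_def)
      finally show ?thesis by (simp add: mult.commute)
    qed
    have ones_n: "\<bar>f (james_ones n)\<bar> \<le> \<delta>"
    proof -
      have "james_ones n - james_rest n (james_ones n) = james_ones n"
        by (auto simp: james_eq_iff)
      then have "\<bar>f (james_ones n)\<bar> \<le> \<delta> * norm (james_ones n)" using head[of "james_ones n"] by simp
      also have "\<dots> \<le> \<delta> * 1" using \<open>0 < \<delta>\<close> norm_james_ones_le by (intro mult_left_mono) auto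
      finally show ?thesis by simp
    qed
    \<comment> \<open>The 4 collects 2 from moving from \<open>n'\<close> to \<open>m\<close>, 1
      from closeness to \<open>z T i\<close>, and 1 from the size of \<open>z T i\<close>.\<close>
    have ones_n': "\<bar>f (james_ones n')\<bar> \<le> 4 * \<delta>"
    proof -
      obtain m where m: "n' \<le> m" "\<bar>f (james_ones m) - z T i\<bar> < \<delta>"
        using z(2)[OF TS \<open>0 < \<delta>\<close>] unfolding f_def by blast
      have "\<bar>f (james_ones m - james_ones n')\<bar> \<le> \<delta> * norm (james_ones m - james_ones n')"
        unfolding f_def using m(1) by (intro tail[OF TS]) simp
      also have "norm (james_ones m - james_ones n') \<le> 2"
        using norm_triangle_ineq4[of "james_ones m" "james_ones n'"]
          norm_james_ones_le[of m] norm_james_ones_le[of n'] by simp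
      finally have "\<bar>f (james_ones m) - f (james_ones n')\<bar> \<le> \<delta> * 2"
        using \<open>0 < \<delta>\<close> by (simp add: f_diff)
      then show ?thesis using m(2) i(3)[OF TS] by linarith
    qed
    \<comment> \<open>Head, tail, oscillation in the window, and the constant \<open>x n'\<close> on
      the window. Head, tail and constant contribute 1 + 2 + 5 = 8 times \<delta>.\<close>
    have "x = (x - james_rest n x) + james_rest n' x + james_window n n' x
        + james_seq x n' *\<^sub>R (james_ones n' - james_ones n)"
      using n' by (auto simp: james_eq_iff james_seq_window)
    then have "f x = f (x - james_rest n x) + f (james_rest n' x) + f (james_window n n' x)
        + james_seq x n' * (f (james_ones n') - f (james_ones n))"
      by (metis f_add f_diff f_scale)
    then have "\<bar>f x\<bar> \<le> \<bar>f (x - james_rest n x)\<bar> + \<bar>f (james_rest n' x)\<bar> + \<bar>f (james_window n n' x)\<bar>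
        + \<bar>james_seq x n' * (f (james_ones n') - f (james_ones n))\<bar>"
      by linarith
    moreover have "\<bar>f (james_rest n' x)\<bar> \<le> 2 * \<delta> * norm x"
    proof -
      have "\<bar>f (james_rest n' x)\<bar> \<le> \<delta> * norm (james_rest n' x)"
        unfolding f_def by (intro tail[OF TS]) simp
      also have "\<dots> \<le> \<delta> * (2 * norm x)"
        using \<open>0 < \<delta>\<close> norm_james_rest_le by (intro mult_left_mono) auto
      finally show ?thesis by simp
    qed
    moreover have "\<bar>james_seq x n' * (f (james_ones n') - f (james_ones n))\<bar> \<le> norm x * (5 * \<delta>)"
      unfolding abs_mult using ones_n ones_n'
      by (intro mult_mono abs_james_seq_le_norm) auto
    moreover have "\<bar>f (james_window n n' x)\<bar> \<le> norm T * norm (james_window n n' x)"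
      unfolding f_def by (rule order_trans[OF abs_james_seq_le_norm norm_blinfun])
    ultimately show ?thesis using head[of x] by (simp add: f_def algebra_simps)
  qed
  with i(1) n' show ?thesis by blast
qed

text \<open>Over \<open>N\<close> consecutive windows the oscillation terms sum to order
  \<open>sqrt N\<close>, so averaging makes them small; the gliding hump with
  \<open>\<epsilon> / 16\<close> leaves an error of half of \<epsilon>.\<close>

lemma null_at_ones_small_average:
  fixes S :: "(james \<Rightarrow>\<^sub>L james) set"
  assumes "finite S" "\<And>T. T \<in> S \<Longrightarrow> null_at_ones T" "0 < \<epsilon>"
  shows "\<exists>l. l \<noteq> [] \<and> set l \<subseteq> {b..} \<and>
    (\<forall>T\<in>S. \<forall>x. \<bar>list_avg (james_seq (blinfun_apply T x)) l\<bar> \<le> \<epsilon> * norm x)"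
proof -
  have "0 < \<epsilon> / 16" using \<open>0 < \<epsilon>\<close> by simp
  from null_at_ones_gliding_hump[OF assms(1,2) this]
  obtain I M where IM: "\<And>n. b \<le> I n" "\<And>n. n \<le> M n" "\<And>n T x. T \<in> S \<Longrightarrow>
      \<bar>james_seq (blinfun_apply T x) (I n)\<bar> \<le> 8 * (\<epsilon> / 16) * norm x + norm T * norm (james_window n (M n) x)"
    by metis
  define m where "m k = (M ^^ k) 0" for k
  have m_Suc: "m (Suc k) = M (m k)" for k by (simp add: m_def)
  define C where "C = (\<Sum>T\<in>S. norm T)"
  have C: "norm T \<le> C" if "T \<in> S" for T
    unfolding C_def using assms(1) that by (intro member_le_sum) auto
  have "0 \<le> C" unfolding C_def by (simp add: sum_nonneg)
  obtain N where N: "(8 * C / \<epsilon>)\<^sup>2 < real N" using reals_Archimedean2 by blast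
  then have "0 < N" by (cases N) (auto simp: not_less)
  have "8 * C / \<epsilon> \<le> sqrt N" using N by (intro real_le_rsqrt) simp
  then have N': "4 * C * sqrt N \<le> N * (\<epsilon> / 2)"
  proof -
    have "8 * C \<le> sqrt N * \<epsilon>" using \<open>8 * C / \<epsilon> \<le> sqrt N\<close> \<open>0 < \<epsilon>\<close> by (simp add: divide_le_eq)
    then have "8 * C * sqrt N \<le> sqrt N * \<epsilon> * sqrt N" by (rule mult_right_mono) simp
    also have "\<dots> = N * \<epsilon>" by simp
    finally show ?thesis by simp
  qed
  define l where "l = map (\<lambda>j. I (m j)) [0..<N]"
  have "\<bar>list_avg (james_seq (blinfun_apply T x)) l\<bar> \<le> \<epsilon> * norm x" if "T \<in> S" for T x
  proof -
    have "\<bar>\<Sum>j<N. james_seq (blinfun_apply T x) (I (m j))\<bar> \<le> (\<Sum>j<N. \<bar>james_seq (blinfun_apply T x) (I (m j))\<bar>)"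
      by (rule sum_abs)
    also have "\<dots> \<le> (\<Sum>j<N. \<epsilon> / 2 * norm x + C * norm (james_window (m j) (m (Suc j)) x))"
    proof (rule sum_mono)
      fix j
      have "norm T * norm (james_window (m j) (m (Suc j)) x) \<le> C * norm (james_window (m j) (m (Suc j)) x)"
        by (intro mult_right_mono C that) simp
      then show "\<bar>james_seq (blinfun_apply T x) (I (m j))\<bar> \<le> \<epsilon> / 2 * norm x + C * norm (james_window (m j) (m (Suc j)) x)"
        using IM(3)[OF that, of x "m j"] by (simp add: m_Suc)
    qed
    also have "\<dots> = N * (\<epsilon> / 2 * norm x) + C * (\<Sum>j<N. norm (james_window (m j) (m (Suc j)) x))"
      by (simp add: sum.distrib sum_distrib_left)
    also have "\<dots> \<le> N * (\<epsilon> / 2 * norm x) + C * (4 * sqrt N * norm x)"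
      using \<open>0 \<le> C\<close> by (intro add_left_mono mult_left_mono sum_norm_james_windows_le) (simp_all add: m_Suc IM)
    also have "\<dots> \<le> N * (\<epsilon> / 2 * norm x) + N * (\<epsilon> / 2) * norm x"
      using mult_right_mono[OF N' norm_ge_zero[of x]] by (simp add: mult_ac)
    also have "\<dots> = N * (\<epsilon> * norm x)" by (simp add: field_simps)
    finally have "\<bar>\<Sum>j<N. james_seq (blinfun_apply T x) (I (m j))\<bar> \<le> N * (\<epsilon> * norm x)" .
    moreover have "list_avg (james_seq (blinfun_apply T x)) l = (\<Sum>j<N. james_seq (blinfun_apply T x) (I (m j))) / N"
      by (simp add: list_avg_def l_def comp_def interv_sum_list_conv_sum_set_nat atLeast0LessThan)
    ultimately show ?thesis using \<open>0 < N\<close> by (simp add: abs_divide pos_divide_le_eq mult_ac)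
  qed
  moreover have "l \<noteq> []" "set l \<subseteq> {b..}" using \<open>0 < N\<close> IM(1) by (auto simp: l_def)
  ultimately show ?thesis by blast
qed

section \<open>Bounded left approximate identities\<close>

text \<open>Finite subsets paired with tolerances \<open>1 / Suc n\<close> index the net, so
  approximating finitely many elements at once with a uniform norm bound suffices.\<close>

lemma has_BLAI_finiteI:
  assumes "\<And>S \<epsilon>. finite S \<Longrightarrow> S \<subseteq> A \<Longrightarrow> 0 < \<epsilon> \<Longrightarrow>
    \<exists>e\<in>A. norm e \<le> C \<and> (\<forall>y\<in>S. norm (y - prd e y) < \<epsilon>)"
  shows "has_BLAI prd A"
proof -
  define I :: "('a set \<times> nat) set" where "I = {(S, n). finite S \<and> S \<subseteq> A}"
  define le :: "('a set \<times> nat) \<Rightarrow> ('a set \<times> nat) \<Rightarrow> bool"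
    where "le = (\<lambda>(S, n) (S', n'). S \<subseteq> S' \<and> n \<le> n')"
  have "\<exists>e\<in>A. norm e \<le> C \<and> (\<forall>y\<in>fst i. norm (y - prd e y) < 1 / Suc (snd i))" if "i \<in> I" for i
    using that by (intro assms) (auto simp: I_def)
  then obtain e where e: "\<And>i. i \<in> I \<Longrightarrow> e i \<in> A" "\<And>i. i \<in> I \<Longrightarrow> norm (e i) \<le> C"
    "\<And>i y. i \<in> I \<Longrightarrow> y \<in> fst i \<Longrightarrow> norm (y - prd (e i) y) < 1 / Suc (snd i)"
    by metis
  have "directed_set I le"
    unfolding directed_set_def
  proof (intro conjI ballI)
    show "I \<noteq> {}" by (auto simp: I_def)
    show "reflp_on I le" by (auto simp: reflp_on_def le_def)
    show "transp_on I le" by (auto simp: transp_on_def le_def)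
    fix i j assume "i \<in> I" "j \<in> I"
    then show "\<exists>k\<in>I. le i k \<and> le j k"
      by (intro bexI[of _ "(fst i \<union> fst j, max (snd i) (snd j))"]) (auto simp: I_def le_def)
  qed
  moreover have "\<exists>i0\<in>I. \<forall>i\<in>I. le i0 i \<longrightarrow> norm (y - prd (e i) y) < \<epsilon>"
    if "y \<in> A" and \<epsilon>: "0 < \<epsilon>" for y \<epsilon>
  proof -
    obtain n where n: "1 / real (Suc n) < \<epsilon>" using nat_approx_posE[OF \<epsilon>] by blast
    have "norm (y - prd (e i) y) < \<epsilon>" if "i \<in> I" "le ({y}, n) i" for i
    proof -
      have "norm (y - prd (e i) y) < 1 / real (Suc (snd i))"
        using that by (intro e(3)) (auto simp: le_def)
      also have "\<dots> \<le> 1 / real (Suc n)"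
        using that by (intro divide_left_mono) (auto simp: le_def)
      also note n
      finally show ?thesis .
    qed
    moreover have "({y}, n) \<in> I" using \<open>y \<in> A\<close> by (simp add: I_def)
    ultimately show ?thesis by blast
  qed
  ultimately show ?thesis
    unfolding has_BLAI_def using e(1,2) by blast
qed

lemma norm_blinfun_le_cball:
  assumes "\<And>x. norm x \<le> 1 \<Longrightarrow> norm (blinfun_apply T x) \<le> b"
  shows "norm T \<le> b"
proof (rule norm_blinfun_bound)
  show "0 \<le> b" using assms[of 0] by simp
  fix x
  show "norm (blinfun_apply T x) \<le> b * norm x"
  proof (cases "x = 0")
    case False
    then show ?thesis
      using assms[of "(1 / norm x) *\<^sub>R x"] by (simp add: blinfun.scaleR_right field_simps)
  qed simp
qed

lemma has_WAP_imp_has_BLAI: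
  fixes smul :: "'k::{real_normed_field, banach} \<Rightarrow> 'e::banach \<Rightarrow> 'e"
  assumes "has_WAP smul"
  shows "has_BLAI (o\<^sub>L) (weakly_compact_operators smul)"
proof -
  let ?W = "weakly_compact_operators smul"
  obtain C where C: "\<And>D \<epsilon>. weakly_compact smul D \<Longrightarrow> \<epsilon> > 0 \<Longrightarrow>
      \<exists>V \<in> ?W. (\<exists>\<delta><\<epsilon>. \<forall>x\<in>D. norm (x - blinfun_apply V x) \<le> \<delta>) \<and> norm V \<le> C"
    using assms unfolding has_WAP_def by metis
  show ?thesis
  proof (rule has_BLAI_finiteI)
    fix S :: "('e \<Rightarrow>\<^sub>L 'e) set" and \<epsilon> :: real
    assume S: "finite S" "S \<subseteq> ?W" and "0 < \<epsilon>"
    let ?D = "\<Union>T\<in>S. weak_topology smul closure_of (blinfun_apply T ` cball 0 1)"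
    have "weakly_compact smul ?D"
      using S by (intro compactin_Union) (auto simp: weakly_compact_operators_def)
    from C[OF this \<open>0 < \<epsilon>\<close>] obtain V \<delta> where V: "V \<in> ?W" "norm V \<le> C" "\<delta> < \<epsilon>"
      "\<And>x. x \<in> ?D \<Longrightarrow> norm (x - blinfun_apply V x) \<le> \<delta>" by blast
    have "norm (T - (V o\<^sub>L T)) < \<epsilon>" if "T \<in> S" for T
    proof -
      \<comment> \<open>Uniform approximation on the image of the unit ball is approximation in
        operator norm; the gap below \<epsilon> keeps the inequality strict.\<close>
      have "norm (T - (V o\<^sub>L T)) \<le> \<delta>"
      proof (rule norm_blinfun_le_cball)
        fix x :: 'e assume "norm x \<le> 1"
        then have "blinfun_apply T x \<in> weak_topology smul closure_of (blinfun_apply T ` cball 0 1)"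
          using closure_of_subset[of "blinfun_apply T ` cball 0 1" "weak_topology smul"] by auto
        then have "blinfun_apply T x \<in> ?D" using that by blast
        then show "norm (blinfun_apply (T - (V o\<^sub>L T)) x) \<le> \<delta>"
          using V(4) by (simp add: blinfun.diff_left)
      qed
      with V(3) show ?thesis by simp
    qed
    with V show "\<exists>V\<in>?W. norm V \<le> C \<and> (\<forall>T\<in>S. norm (T - (V o\<^sub>L T)) < \<epsilon>)" by blast
  qed
qed

lemma has_BLAI_james: "has_BLAI (o\<^sub>L) (weakly_compact_operators ((*\<^sub>R) :: real \<Rightarrow> james \<Rightarrow> james))"
proof (rule has_BLAI_finiteI)
  let ?W = "weakly_compact_operators ((*\<^sub>R) :: real \<Rightarrow> james \<Rightarrow> james)"
  fix S :: "(james \<Rightarrow>\<^sub>L james) set" and \<epsilon> :: real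
  assume S: "finite S" "S \<subseteq> ?W" and "0 < \<epsilon>"
  \<comment> \<open>The tolerance halves from block to block; \<open>james_bound_geometric\<close>
    then gives a total of two thirds of \<epsilon>.\<close>
  have "\<exists>l. l \<noteq> [] \<and> set l \<subseteq> {b..} \<and>
      (\<forall>T\<in>S. \<forall>x. \<bar>list_avg (james_seq (blinfun_apply T x)) l\<bar> \<le> \<epsilon> / 3 / 2 ^ k * norm x)" for b k
    using S \<open>0 < \<epsilon>\<close> by (intro null_at_ones_small_average weakly_compact_null_at_ones) auto
  then obtain l where l: "\<And>b k. l b k \<noteq> []" "\<And>b k. set (l b k) \<subseteq> {b..}"
    "\<And>b k T x. T \<in> S \<Longrightarrow> \<bar>list_avg (james_seq (blinfun_apply T x)) (l b k)\<bar> \<le> \<epsilon> / 3 / 2 ^ k * norm x"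
    by metis
  \<comment> \<open>Block \<open>k\<close> starts at \<open>b k\<close>, and the next one just after
    the largest index in \<open>L k\<close>.\<close>
  define b where "b = rec_nat 0 (\<lambda>k m. Suc (Max (set (l m k))))"
  define L where "L k = l (b k) k" for k
  have b_Suc: "b (Suc k) = Suc (Max (set (L k)))" for k by (simp add: b_def L_def)
  have L: "b k \<le> j" "j < b (Suc k)" if "j \<in> set (L k)" for j k
    using that l(2)[of "b k" k] by (auto simp: L_def b_Suc less_Suc_eq_le)
  have "b k < b (Suc k)" for k
    using L[of "hd (L k)" k] l(1) by (metis L_def hd_in_set le_less_trans)
  then have b_mono: "strict_mono b" by (simp add: strict_mono_Suc_iff)
  define \<kappa> where "\<kappa> i = (LEAST k. i < b (Suc k))" for i
  have \<kappa>: "i < b (Suc (\<kappa> i))" for i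
    unfolding \<kappa>_def by (rule LeastI[of _ i]) (use strict_mono_imp_increasing[OF b_mono, of "Suc i"] in simp)
  interpret index_blocks \<kappa> L
  proof
    show "mono \<kappa>"
    proof (rule monoI)
      fix i j :: nat assume "i \<le> j"
      then show "\<kappa> i \<le> \<kappa> j" unfolding \<kappa>_def[of i] using \<kappa>[of j] by (intro Least_le) simp
    qed
    show "L k \<noteq> []" for k by (simp add: L_def l)
    show "\<kappa> j = k" if "j \<in> set (L k)" for j k
      unfolding \<kappa>_def
    proof (rule Least_equality)
      show "j < b (Suc k)" using L[OF that] by simp
      fix k' assume "j < b (Suc k')"
      with L(1)[OF that] have "b k < b (Suc k')" by simp
      then show "k \<le> k'" using b_mono by (simp add: strict_mono_less less_Suc_eq_le)
    qed
  qed
  have "norm (T - (osc_op o\<^sub>L T)) < \<epsilon>" if "T \<in> S" for T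
  proof -
    have "norm (T - (osc_op o\<^sub>L T)) \<le> 2 * (\<epsilon> / 3)"
    proof (rule norm_blinfun_bound)
      fix x
      \<comment> \<open>\<open>avg_op (T x)\<close> repeats the block averages along \<kappa>, so a
        bound for the sequence of averages bounds its norm.\<close>
      have "james_bound (\<lambda>k. list_avg (james_seq (blinfun_apply T x)) (L k)) (2 * (\<epsilon> / 3 * norm x))"
        using l(3)[OF that] by (intro james_bound_geometric) (simp add: L_def)
      from james_bound_comp_mono[OF this mono_\<kappa>]
      have "norm (avg_op (T x)) \<le> 2 * (\<epsilon> / 3 * norm x)" by (intro norm_james_le) simp
      then show "norm ((T - (osc_op o\<^sub>L T)) x) \<le> 2 * (\<epsilon> / 3) * norm x"
        by (simp add: blinfun.diff_left)
    qed (use \<open>0 < \<epsilon>\<close> in simp)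
    then show ?thesis using \<open>0 < \<epsilon>\<close> by simp
  qed
  with osc_op_weakly_compact norm_osc_op_le
  show "\<exists>V\<in>?W. norm V \<le> 2 \<and> (\<forall>T\<in>S. norm (T - (V o\<^sub>L T)) < \<epsilon>)" by blast
qed

theorem proposition2p5:
  fixes smul :: "'k::{real_normed_field, banach} \<Rightarrow> 'e::banach \<Rightarrow> 'e"
  shows "(banach_space_over smul \<longrightarrow> has_WAP smul \<longrightarrow>
           has_BLAI (o\<^sub>L) (weakly_compact_operators smul)) \<and>
         has_BLAI (o\<^sub>L) (weakly_compact_operators ((*\<^sub>R) :: real \<Rightarrow> james \<Rightarrow> james))"
  by (simp add: has_WAP_imp_has_BLAI has_BLAI_james)

end
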